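(* Let $A\in\mathbb{C}^{n\times N}$ have unit-norm columns, let $S\subset\{1,\dots,N\}$ with $|S|=k$ and $\delta(S)<1$, $\mu_2(S)<1$, and assume that for some $\epsilon\in(0,1)$ $$\frac{\mu_2(S)^2+\frac{1+\epsilon}{1-\epsilon}\mu_2(S)}{1-\delta(S)}\le1.$$ Let $X\in\mathbb{R}^{N\times L}$ have all rows outside $S$ equal to zero and $X^S=\Sigma\Phi$, where $\Sigma$ is a diagonal matrix with positive diagonal entries and $\Phi\in\mathbb{R}^{k\times L}$ has independent standard normal entries, and let $Y=AX$. Then $2$-SOMP applied to $Y$ selects exactly the indices of $S$ in its first $k$ iterations (and hence recovers $X$) with probability at least $$1-N\,2^k\exp(-\epsilon^2A_L^2),\qquad A_L=\sqrt2\,\frac{\Gamma((L+1)/2)}{\Gamma(L/2)}.$$ If instead $\Phi\in\mathbb{C}^{k\times L}$ has entries whose real and imaginary parts are independent standard normal, the same conclusion holds with $L$ replaced by $2L$ in this bound.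
   Context: $a_\ell$ is the $\ell$-th column of $A$, $A_S$ the submatrix of columns indexed by $S$, $A_S^\dagger=(A_S^*A_S)^{-1}A_S^*$, $\|\cdot\|_2$ the spectral norm, $X^S$ the rows of $X$ indexed by $S$. $\delta(S)=\|A_S^*A_S-I\|_2$; $\mu_2(S)=\max\{\max_{\ell\notin S}\|A_S^*a_\ell\|_2,\ \max_{\ell\in S}\|A_{S\setminus\{\ell\}}^*a_\ell\|_2\}$. $2$-SOMP: set $Y_0=Y$, $S_0=\emptyset$; at iteration $M+1$ select an index $\ell_{M+1}$ maximizing $\|a_\ell^*Y_M\|_2$ over $1\le\ell\le N$, set $S_{M+1}=S_M\cup\{\ell_{M+1}\}$, $X_{M+1}=A_{S_{M+1}}^\dagger Y$, and $Y_{M+1}=Y-A_{S_{M+1}}X_{M+1}=(I-A_{S_{M+1}}A_{S_{M+1}}^\dagger)Y$. $\Gamma$ is the Gamma function. *)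

theory Defs
  imports "HOL-Probability.Probability"
begin

text \<open>Matrices are functions nat => nat => complex (row, column), with explicit
  dimensions; A is n x N, column l of A is (\<lambda>r. A r l), r < n, l < N.
  Column-index sets are subsets of {0..<N}.\<close>

definition vnorm :: "nat set \<Rightarrow> (nat \<Rightarrow> complex) \<Rightarrow> real" where
  "vnorm I v = sqrt (\<Sum>i\<in>I. (cmod (v i))^2)"

definition opnorm :: "nat set \<Rightarrow> (nat \<Rightarrow> nat \<Rightarrow> complex) \<Rightarrow> real" where
  "opnorm T B = Sup {vnorm T (\<lambda>i. \<Sum>j\<in>T. B i j * v j) | v. vnorm T v \<le> 1}"

definition gram :: "(nat \<Rightarrow> nat \<Rightarrow> complex) \<Rightarrow> nat \<Rightarrow> nat \<Rightarrow> nat \<Rightarrow> complex" where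
  "gram A n i j = (\<Sum>r<n. cnj (A r i) * A r j)"

definition delta :: "(nat \<Rightarrow> nat \<Rightarrow> complex) \<Rightarrow> nat \<Rightarrow> nat set \<Rightarrow> real" where
  "delta A n S = opnorm S (\<lambda>i j. gram A n i j - (if i = j then 1 else 0))"

text \<open>mu_2(S) = max( max_{l notin S} ||A_S^* a_l||_2 , max_{l in S} ||A_{S-{l}}^* a_l||_2 ).
  The extra 0 only guards against an empty range (all quantities are nonnegative).\<close>
definition mu2 :: "(nat \<Rightarrow> nat \<Rightarrow> complex) \<Rightarrow> nat \<Rightarrow> nat \<Rightarrow> nat set \<Rightarrow> real" where
  "mu2 A n N S = Max (insert 0
      ((\<lambda>l. vnorm S (\<lambda>i. gram A n i l)) ` ({0..<N} - S) \<union>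
       (\<lambda>l. vnorm (S - {l}) (\<lambda>i. gram A n i l)) ` S))"

text \<open>X_T = A_T^dagger Y = (A_T^* A_T)^{-1} A_T^* Y, given as the unique matrix
  (rows supported on T, columns in {0..<L}) solving A_T^* A_T X = A_T^* Y.\<close>
definition lsq :: "(nat \<Rightarrow> nat \<Rightarrow> complex) \<Rightarrow> nat \<Rightarrow> nat \<Rightarrow> nat set \<Rightarrow>
    (nat \<Rightarrow> nat \<Rightarrow> complex) \<Rightarrow> nat \<Rightarrow> nat \<Rightarrow> complex" where
  "lsq A n L T Y = (THE X. (\<forall>i j. (i \<notin> T \<or> j \<ge> L) \<longrightarrow> X i j = 0) \<and>
      (\<forall>i\<in>T. \<forall>j<L. (\<Sum>l\<in>T. gram A n i l * X l j) = (\<Sum>r<n. cnj (A r i) * Y r j)))"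

definition resid :: "(nat \<Rightarrow> nat \<Rightarrow> complex) \<Rightarrow> nat \<Rightarrow> nat \<Rightarrow> nat set \<Rightarrow>
    (nat \<Rightarrow> nat \<Rightarrow> complex) \<Rightarrow> nat \<Rightarrow> nat \<Rightarrow> complex" where
  "resid A n L T Y = (\<lambda>r j. Y r j - (\<Sum>l\<in>T. A r l * lsq A n L T Y l j))"

definition corr :: "(nat \<Rightarrow> nat \<Rightarrow> complex) \<Rightarrow> nat \<Rightarrow> nat \<Rightarrow>
    (nat \<Rightarrow> nat \<Rightarrow> complex) \<Rightarrow> nat \<Rightarrow> real" where
  "corr A n L Z l = vnorm {0..<L} (\<lambda>j. \<Sum>r<n. cnj (A r l) * Z r j)"

text \<open>sel is a valid sequence of index choices of 2-SOMP for the first k iterations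
  (sel M is the index chosen at iteration M+1; any tie-breaking allowed):
  sel M maximises ||a_l^* Y_M||_2 over l < N, where Y_M is the residual after
  selecting S_M = {sel 0, ..., sel (M-1)}.\<close>
definition somp_run :: "(nat \<Rightarrow> nat \<Rightarrow> complex) \<Rightarrow> nat \<Rightarrow> nat \<Rightarrow> nat \<Rightarrow>
    (nat \<Rightarrow> nat \<Rightarrow> complex) \<Rightarrow> nat \<Rightarrow> (nat \<Rightarrow> nat) \<Rightarrow> bool" where
  "somp_run A n N L Y k sel \<longleftrightarrow> (\<forall>M<k. sel M < N \<and>
      (\<forall>l<N. corr A n L (resid A n L (sel ` {..<M}) Y) l
             \<le> corr A n L (resid A n L (sel ` {..<M}) Y) (sel M)))"

definition somp_selects :: "(nat \<Rightarrow> nat \<Rightarrow> complex) \<Rightarrow> nat \<Rightarrow> nat \<Rightarrow> nat \<Rightarrow>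
    (nat \<Rightarrow> nat \<Rightarrow> complex) \<Rightarrow> nat set \<Rightarrow> bool" where
  "somp_selects A n N L Y S \<longleftrightarrow>
     (\<forall>sel. somp_run A n N L Y (card S) sel \<longrightarrow> sel ` {..<card S} = S)"

definition matmul :: "(nat \<Rightarrow> nat \<Rightarrow> complex) \<Rightarrow> nat \<Rightarrow> (nat \<Rightarrow> nat \<Rightarrow> complex) \<Rightarrow>
    nat \<Rightarrow> nat \<Rightarrow> complex" where
  "matmul A N X = (\<lambda>r j. \<Sum>l<N. A r l * X l j)"

definition A_const :: "nat \<Rightarrow> real" where
  "A_const L = sqrt 2 * Gamma ((real L + 1) / 2) / Gamma (real L / 2)"

end

theory Submission
  imports Defs
begin

text \<open>
  After the indices \<open>J \<subset> S\<close> have been selected, the correlation of the residual with column \<open>l\<close> is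
  \<open>\<parallel>u\<^sub>l\<^sup>* \<Phi>\<parallel>\<close>, where \<open>u\<^sub>l\<close> is the deterministic vector with entries \<open>\<sigma>\<^sub>s a\<^sub>l\<^sup>* (I - A\<^sub>J A\<^sub>J\<^sup>\<dagger>) a\<^sub>s\<close>, up to
  conjugation. The hypothesis guarantees that \<open>(1 + \<epsilon>) \<parallel>u\<^sub>m\<parallel> \<le> (1 - \<epsilon>) \<parallel>u\<^sub>l\<parallel>\<close> for \<open>m \<notin> S\<close> and the
  index \<open>l \<in> S - J\<close> with the largest \<open>\<sigma>\<^sub>l\<close>. So it suffices that \<open>\<parallel>u\<^sub>m\<^sup>* \<Phi>\<parallel> \<le> (1 + \<epsilon>) \<tau> \<parallel>u\<^sub>m\<parallel>\<close> for all
  \<open>m \<notin> S\<close> and \<open>\<parallel>u\<^sub>l\<^sup>* \<Phi>\<parallel> > (1 - \<epsilon>) \<tau> \<parallel>u\<^sub>l\<parallel>\<close> for this single \<open>l\<close>: at most \<open>N\<close> events for each of the fewer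
  than \<open>2\<^sup>k\<close> proper subsets \<open>J\<close>.

  With \<open>K = L\<close> or \<open>K = 2 L\<close> real degrees of freedom, the moment generating function of
  \<open>\<parallel>u\<^sup>* \<Phi>\<parallel>\<^sup>2\<close> is bounded by \<open>(1 - 2 t \<parallel>u\<parallel>\<^sup>2)\<close> to the power \<open>- K / 2\<close>, and Chernoff's bound applies. Gaussian
  concentration for Lipschitz functions would only give the exponent \<open>\<epsilon>\<^sup>2 A\<^sub>K\<^sup>2 / 2\<close>. The missing factor
  is recovered by centring at \<open>\<tau>\<^sup>2 = K artanh \<epsilon> / \<epsilon>\<close> instead of \<open>A\<^sub>K\<^sup>2\<close>: both tails are then at most
  \<open>exp (- \<epsilon>\<^sup>2 K)\<close>, and \<open>A\<^sub>K\<^sup>2 \<le> K\<close> by log-convexity of \<open>\<Gamma>\<close>.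
\<close>

section \<open>Residual correlations\<close>

lemma vnorm_eq_L2_set: "vnorm I v = L2_set (\<lambda>i. cmod (v i)) I"
  by (simp add: vnorm_def L2_set_def)

lemma vnorm_nonneg [simp]: "0 \<le> vnorm I v"
  by (simp add: vnorm_eq_L2_set)

lemma vnorm_cong: "(\<And>i. i \<in> I \<Longrightarrow> v i = w i) \<Longrightarrow> vnorm I v = vnorm I w"
  by (simp add: vnorm_def)

lemma vnorm_cnj [simp]: "vnorm I (\<lambda>i. cnj (v i)) = vnorm I v"
  by (simp add: vnorm_def)

lemma vnorm_eq_0_iff: "finite I \<Longrightarrow> vnorm I v = 0 \<longleftrightarrow> (\<forall>i\<in>I. v i = 0)"
  by (simp add: vnorm_eq_L2_set L2_set_eq_0_iff)

lemma vnorm_scale: "vnorm I (\<lambda>i. c * v i) = cmod c * vnorm I v"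
  by (simp add: vnorm_eq_L2_set norm_mult L2_set_right_distrib)

lemma vnorm_diff_commute: "vnorm I (\<lambda>i. v i - w i) = vnorm I (\<lambda>i. w i - v i)"
  by (simp add: vnorm_def norm_minus_commute)

lemma vnorm_triangle: "vnorm I (\<lambda>i. v i + w i) \<le> vnorm I v + vnorm I w"
proof -
  have "vnorm I (\<lambda>i. v i + w i) \<le> L2_set (\<lambda>i. cmod (v i) + cmod (w i)) I"
    unfolding vnorm_eq_L2_set by (intro L2_set_mono) (auto intro: norm_triangle_ineq)
  also have "\<dots> \<le> vnorm I v + vnorm I w"
    unfolding vnorm_eq_L2_set by (rule L2_set_triangle_ineq)
  finally show ?thesis .
qed

lemma vnorm_triangle_diff: "vnorm I (\<lambda>i. v i - w i) \<le> vnorm I v + vnorm I w"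
  using vnorm_triangle[of I v "\<lambda>i. - w i"] by (simp add: vnorm_def)

lemma vnorm_subset_mono: "finite I \<Longrightarrow> J \<subseteq> I \<Longrightarrow> vnorm J v \<le> vnorm I v"
  unfolding vnorm_def by (intro real_sqrt_le_mono sum_mono2) auto

lemma vnorm_mono: "(\<And>i. i \<in> I \<Longrightarrow> cmod (v i) \<le> cmod (w i)) \<Longrightarrow> vnorm I v \<le> vnorm I w"
  unfolding vnorm_eq_L2_set by (intro L2_set_mono) auto

lemma cmod_le_vnorm: "finite I \<Longrightarrow> i \<in> I \<Longrightarrow> cmod (v i) \<le> vnorm I v"
  unfolding vnorm_eq_L2_set using member_le_L2_set[of I i "\<lambda>i. cmod (v i)"] by simp

lemma vnorm_le_sum: "vnorm I v \<le> (\<Sum>i\<in>I. cmod (v i))"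
  unfolding vnorm_eq_L2_set by (intro L2_set_le_sum) auto

lemma vnorm_Cauchy_Schwarz: "cmod (\<Sum>i\<in>I. v i * w i) \<le> vnorm I v * vnorm I w"
proof -
  have "cmod (\<Sum>i\<in>I. v i * w i) \<le> (\<Sum>i\<in>I. \<bar>cmod (v i)\<bar> * \<bar>cmod (w i)\<bar>)"
    by (intro sum_norm_le) (simp add: norm_mult)
  also have "\<dots> \<le> vnorm I v * vnorm I w"
    unfolding vnorm_eq_L2_set by (rule L2_set_mult_ineq)
  finally show ?thesis .
qed

text \<open>A supremum of reals is informative only for a set that is bounded above; here the sum of
  the moduli of all entries is a bound. Homogeneity then carries the estimate from the unit ball to
  every vector.\<close>

lemma opnorm_nonneg_bound:
  assumes "finite T"
  shows "0 \<le> opnorm T B \<and> vnorm T (\<lambda>i. \<Sum>j\<in>T. B i j * v j) \<le> opnorm T B * vnorm T v"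
proof -
  let ?B = "\<lambda>v i. \<Sum>j\<in>T. B i j * v j"
  let ?V = "{vnorm T (?B v) | v. vnorm T v \<le> 1}"
  have bdd: "bdd_above ?V"
  proof (rule bdd_aboveI)
    fix x assume "x \<in> ?V"
    then obtain v where v: "vnorm T v \<le> 1" and x: "x = vnorm T (?B v)" by auto
    have "x \<le> (\<Sum>i\<in>T. cmod (?B v i))" unfolding x by (rule vnorm_le_sum)
    also have "\<dots> \<le> (\<Sum>i\<in>T. \<Sum>j\<in>T. cmod (B i j))"
    proof (intro sum_mono sum_norm_le)
      fix i j assume "j \<in> T"
      then have "cmod (v j) \<le> 1" using cmod_le_vnorm[OF assms, of j v] v by linarith
      then show "cmod (B i j * v j) \<le> cmod (B i j)"
        by (simp add: norm_mult mult_left_le)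
    qed
    finally show "x \<le> (\<Sum>i\<in>T. \<Sum>j\<in>T. cmod (B i j))" .
  qed
  have le: "vnorm T (?B w) \<le> opnorm T B" if "vnorm T w \<le> 1" for w
    unfolding opnorm_def using that by (intro cSup_upper[OF _ bdd]) auto
  have "0 \<le> opnorm T B"
    using le[of "\<lambda>_. 0"] by (simp add: vnorm_def)
  moreover have "vnorm T (?B v) \<le> opnorm T B * vnorm T v"
  proof (cases "vnorm T v = 0")
    case True
    then have "vnorm T (?B v) = 0"
      using assms by (simp add: vnorm_eq_0_iff)
    with True show ?thesis by simp
  next
    case False
    then have pos: "vnorm T v > 0" using vnorm_nonneg[of T v] by linarith
    let ?c = "complex_of_real (1 / vnorm T v)"
    have "vnorm T (?B (\<lambda>j. ?c * v j)) \<le> opnorm T B"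
      using pos by (intro le) (simp add: vnorm_scale del: of_real_divide)
    moreover have "?B (\<lambda>j. ?c * v j) = (\<lambda>i. ?c * ?B v i)"
      by (simp add: sum_distrib_left mult_ac)
    ultimately have "(1 / vnorm T v) * vnorm T (?B v) \<le> opnorm T B"
      using pos by (simp add: vnorm_scale del: of_real_divide)
    then show ?thesis using pos by (simp add: field_simps)
  qed
  ultimately show ?thesis by blast
qed

text \<open>Neumann series: \<open>G = I + (G - I)\<close> with \<open>G - I\<close> a contraction.\<close>

lemma near_identity_solvable:
  assumes fin: "finite T" and d: "0 \<le> d" "d < 1"
    and contr: "\<And>v. vnorm T (\<lambda>i. v i - (\<Sum>j\<in>T. G i j * v j)) \<le> d * vnorm T v"
  shows "\<exists>x. \<forall>i\<in>T. (\<Sum>j\<in>T. G i j * x j) = y i"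
proof -
  \<comment> \<open>On \<open>T\<close>, the fixed points of \<open>f\<close> are the solutions. The
    increments of the iteration from 0 decay geometrically, so every coordinate in \<open>T\<close>
    converges.\<close>
  define f where "f x i = y i + (x i - (\<Sum>j\<in>T. G i j * x j))" for x i
  define X where "X m = (f ^^ m) (\<lambda>_. 0)" for m
  have X_Suc: "X (Suc m) = f (X m)" for m by (simp add: X_def)
  have step: "vnorm T (\<lambda>i. X (Suc m) i - X m i) \<le> d ^ m * vnorm T (X 1)" for m
  proof (induction m)
    case 0
    then show ?case by (simp add: X_def)
  next
    case (Suc m)
    let ?D = "\<lambda>i. X (Suc m) i - X m i"
    have "X (Suc (Suc m)) i - X (Suc m) i = ?D i - (\<Sum>j\<in>T. G i j * ?D j)" for i
    proof -
      have "X (Suc (Suc m)) i - X (Suc m) i = f (X (Suc m)) i - f (X m) i"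
        by (simp only: X_Suc)
      then show ?thesis by (simp add: f_def sum_subtractf algebra_simps)
    qed
    then have "vnorm T (\<lambda>i. X (Suc (Suc m)) i - X (Suc m) i) \<le> d * vnorm T ?D"
      using contr[of ?D] by (simp only:)
    also have "\<dots> \<le> d * (d ^ m * vnorm T (X 1))"
      using Suc.IH d by (intro mult_left_mono) auto
    finally show ?case by (simp add: mult_ac)
  qed
  have conv: "convergent (\<lambda>m. X m i)" if "i \<in> T" for i
  proof -
    have "summable (\<lambda>m. X (Suc m) i - X m i)"
    proof (rule summable_comparison_test')
      show "summable (\<lambda>m. d ^ m * vnorm T (X 1))"
        using d by (intro summable_mult2 summable_geometric) auto
      show "norm (X (Suc m) i - X m i) \<le> d ^ m * vnorm T (X 1)" if "m \<ge> 0" for m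
        using cmod_le_vnorm[OF fin \<open>i \<in> T\<close>, of "\<lambda>i. X (Suc m) i - X m i"] step[of m] by simp
    qed
    moreover have "X 0 i = 0" by (simp add: X_def)
    ultimately show ?thesis
      by (simp add: summable_iff_convergent sum_lessThan_telescope[where f="\<lambda>m. X m i"])
  qed
  define x where "x i = lim (\<lambda>m. X m i)" for i
  have lim: "(\<lambda>m. X m i) \<longlonglongrightarrow> x i" if "i \<in> T" for i
    using conv[OF that] by (simp add: x_def convergent_LIMSEQ_iff)
  have "(\<Sum>j\<in>T. G i j * x j) = y i" if i: "i \<in> T" for i
  proof -
    have "(\<lambda>m. f (X m) i) \<longlonglongrightarrow> f x i"
      unfolding f_def using i by (intro tendsto_intros lim) auto
    moreover have "(\<lambda>m. f (X m) i) \<longlonglongrightarrow> x i"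
      using LIMSEQ_Suc[OF lim[OF i]] by (simp add: X_Suc)
    ultimately have "f x i = x i" by (rule LIMSEQ_unique)
    then show ?thesis by (simp add: f_def)
  qed
  then show ?thesis by blast
qed

section \<open>Gram matrices, orthogonal projections and least squares\<close>

lemma gram_cnj: "cnj (gram A n i j) = gram A n j i"
  by (simp add: gram_def mult.commute)

text \<open>Coefficients of the orthogonal projection of the column \<open>l\<close> onto the columns indexed by \<open>J\<close>.\<close>

definition proj_coeff :: "(nat \<Rightarrow> nat \<Rightarrow> complex) \<Rightarrow> nat \<Rightarrow> nat set \<Rightarrow> nat \<Rightarrow> nat \<Rightarrow> complex" where
  "proj_coeff A n J l = (SOME p. \<forall>i\<in>J. (\<Sum>m\<in>J. gram A n i m * p m) = gram A n i l)"

text \<open>In matrix notation, \<open>a\<^sub>l\<^sup>* (I - A\<^sub>J A\<^sub>J\<^sup>\<dagger>) a\<^sub>s\<close>.\<close>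

definition res_gram :: "(nat \<Rightarrow> nat \<Rightarrow> complex) \<Rightarrow> nat \<Rightarrow> nat set \<Rightarrow> nat \<Rightarrow> nat \<Rightarrow> complex" where
  "res_gram A n J l s = gram A n l s - (\<Sum>m\<in>J. gram A n l m * proj_coeff A n J s m)"

locale stable_support =
  fixes A :: "nat \<Rightarrow> nat \<Rightarrow> complex" and n :: nat and S :: "nat set"
  assumes finite_support: "finite S" and delta_less_1: "delta A n S < 1"
begin

abbreviation G :: "nat \<Rightarrow> nat \<Rightarrow> complex" where "G \<equiv> gram A n"
abbreviation \<delta> :: real where "\<delta> \<equiv> delta A n S"

lemma delta_nonneg: "0 \<le> \<delta>"
  using opnorm_nonneg_bound[OF finite_support] by (simp add: delta_def)

text \<open>Extend \<open>v\<close> by zero from \<open>J\<close> to \<open>S\<close>. Measuring the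
  image on all of \<open>S\<close> yields two estimates at once: the rows in \<open>J\<close> show
  that the Gram matrix of \<open>J\<close> is close to the identity, and the rows in
  \<open>S - J\<close> bound an off-diagonal block.\<close>

lemma gram_diff_bound:
  assumes J: "J \<subseteq> S"
  shows "vnorm S (\<lambda>i. (\<Sum>j\<in>J. G i j * v j) - (if i \<in> J then v i else 0)) \<le> \<delta> * vnorm J v"
proof -
  let ?v = "\<lambda>i. if i \<in> J then v i else 0"
  have 1: "(\<Sum>j\<in>S. (G i j - (if i = j then 1 else 0)) * ?v j) = (\<Sum>j\<in>J. G i j * v j) - ?v i"
    if "i \<in> S" for i
  proof -
    have "(\<Sum>j\<in>S. (G i j - (if i = j then 1 else 0)) * ?v j)
        = (\<Sum>j\<in>S. G i j * ?v j) - (\<Sum>j\<in>S. (if i = j then 1 else 0) * ?v j)"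
      by (simp add: sum_subtractf left_diff_distrib)
    also have "(\<Sum>j\<in>S. (if i = j then 1 else 0) * ?v j) = (\<Sum>j\<in>S. if i = j then ?v j else 0)"
      by (intro sum.cong) auto
    also have "\<dots> = ?v i" using that finite_support by simp
    also have "(\<Sum>j\<in>S. G i j * ?v j) = (\<Sum>j\<in>J. G i j * v j)"
      using J finite_support by (intro sum.mono_neutral_cong_right) auto
    finally show ?thesis .
  qed
  have "vnorm S ?v = vnorm J v"
    unfolding vnorm_def using J finite_support
    by (intro arg_cong[where f=sqrt] sum.mono_neutral_cong_right) auto
  moreover have "vnorm S (\<lambda>i. \<Sum>j\<in>S. (G i j - (if i = j then 1 else 0)) * ?v j) \<le> \<delta> * vnorm S ?v"
    unfolding delta_def by (rule opnorm_nonneg_bound[OF finite_support, THEN conjunct2])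
  ultimately show ?thesis using 1 by (simp cong: vnorm_cong)
qed

lemma gram_contraction:
  assumes J: "J \<subseteq> S"
  shows "vnorm J (\<lambda>i. v i - (\<Sum>j\<in>J. G i j * v j)) \<le> \<delta> * vnorm J v"
proof -
  have "vnorm J (\<lambda>i. v i - (\<Sum>j\<in>J. G i j * v j)) = vnorm J (\<lambda>i. (\<Sum>j\<in>J. G i j * v j) - v i)"
    by (rule vnorm_diff_commute)
  also have "\<dots> = vnorm J (\<lambda>i. (\<Sum>j\<in>J. G i j * v j) - (if i \<in> J then v i else 0))"
    by (rule vnorm_cong) simp
  also have "\<dots> \<le> vnorm S (\<lambda>i. (\<Sum>j\<in>J. G i j * v j) - (if i \<in> J then v i else 0))"
    by (rule vnorm_subset_mono[OF finite_support J])
  also have "\<dots> \<le> \<delta> * vnorm J v" by (rule gram_diff_bound[OF J])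
  finally show ?thesis .
qed

lemma gram_lower_bound:
  assumes J: "J \<subseteq> S"
  shows "(1 - \<delta>) * vnorm J v \<le> vnorm J (\<lambda>i. \<Sum>j\<in>J. G i j * v j)"
proof -
  have "vnorm J v \<le> vnorm J (\<lambda>i. v i - (\<Sum>j\<in>J. G i j * v j)) + vnorm J (\<lambda>i. \<Sum>j\<in>J. G i j * v j)"
    using vnorm_triangle[of J "\<lambda>i. v i - (\<Sum>j\<in>J. G i j * v j)" "\<lambda>i. \<Sum>j\<in>J. G i j * v j"] by simp
  with gram_contraction[OF J, of v] show ?thesis by (simp add: algebra_simps)
qed

text \<open>The lower bound forces the difference of two solutions to vanish. This uniqueness
  justifies the definite description in \<open>lsq\<close>.\<close>

lemma gram_injective:
  assumes J: "J \<subseteq> S" and eq: "\<And>i. i \<in> J \<Longrightarrow> (\<Sum>j\<in>J. G i j * v j) = (\<Sum>j\<in>J. G i j * w j)" and "i \<in> J"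
  shows "v i = w i"
proof -
  have finJ: "finite J" using J finite_support finite_subset by blast
  have "vnorm J (\<lambda>i. \<Sum>j\<in>J. G i j * (v j - w j)) = 0"
    using finJ eq by (simp add: vnorm_eq_0_iff right_diff_distrib sum_subtractf)
  then have "(1 - \<delta>) * vnorm J (\<lambda>i. v i - w i) \<le> 0"
    using gram_lower_bound[OF J, of "\<lambda>i. v i - w i"] by simp
  then have "vnorm J (\<lambda>i. v i - w i) = 0"
    using delta_less_1 vnorm_nonneg[of J "\<lambda>i. v i - w i"] by (simp add: mult_le_0_iff)
  then show ?thesis using finJ \<open>i \<in> J\<close> by (simp add: vnorm_eq_0_iff)
qed

text \<open>The Neumann series supplies a solution of the normal equations, so the choice in
  \<open>proj_coeff\<close> picks a genuine one.\<close>

lemma proj_coeff_eq: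
  assumes J: "J \<subseteq> S" and "i \<in> J"
  shows "(\<Sum>m\<in>J. G i m * proj_coeff A n J l m) = G i l"
proof -
  have "\<exists>p. \<forall>i\<in>J. (\<Sum>m\<in>J. G i m * p m) = G i l"
    using J finite_support finite_subset
    by (intro near_identity_solvable[OF _ delta_nonneg delta_less_1] gram_contraction) blast+
  from someI_ex[OF this] show ?thesis
    using \<open>i \<in> J\<close> unfolding proj_coeff_def by blast
qed

text \<open>Residuals are orthogonal to the columns already selected, which is why no index is
  selected twice.\<close>

lemma res_gram_left_zero: "J \<subseteq> S \<Longrightarrow> l \<in> J \<Longrightarrow> res_gram A n J l s = 0"
  by (simp add: res_gram_def proj_coeff_eq)

text \<open>Orthogonal projections are self-adjoint. Concretely, the normal equations for
  \<open>l\<close> are substituted, the sums are swapped, and the normal equations for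
  \<open>s\<close> collapse the inner sum.\<close>

lemma res_gram_cnj:
  assumes J: "J \<subseteq> S"
  shows "cnj (res_gram A n J l s) = res_gram A n J s l"
proof -
  let ?p = "proj_coeff A n J"
  have "(\<Sum>m\<in>J. G m l * cnj (?p s m)) = (\<Sum>m\<in>J. (\<Sum>i\<in>J. G m i * ?p l i) * cnj (?p s m))"
    using J by (simp add: proj_coeff_eq)
  also have "\<dots> = (\<Sum>m\<in>J. \<Sum>i\<in>J. ?p l i * (cnj (G i m) * cnj (?p s m)))"
    by (simp only: sum_distrib_right gram_cnj) (simp add: mult_ac)
  also have "\<dots> = (\<Sum>i\<in>J. ?p l i * cnj (\<Sum>m\<in>J. G i m * ?p s m))"
    by (subst sum.swap) (simp add: sum_distrib_left)
  also have "\<dots> = (\<Sum>i\<in>J. G s i * ?p l i)"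
    using J by (simp add: proj_coeff_eq gram_cnj mult.commute)
  finally show ?thesis by (simp add: res_gram_def gram_cnj)
qed

lemma res_gram_right_zero: "J \<subseteq> S \<Longrightarrow> s \<in> J \<Longrightarrow> res_gram A n J l s = 0"
  using res_gram_cnj[of J l s] by (simp add: res_gram_left_zero)

lemma proj_coeff_bound:
  assumes J: "J \<subseteq> S"
  shows "vnorm J (proj_coeff A n J l) \<le> vnorm J (\<lambda>i. G i l) / (1 - \<delta>)"
proof -
  have "(1 - \<delta>) * vnorm J (proj_coeff A n J l) \<le> vnorm J (\<lambda>i. G i l)"
    using gram_lower_bound[OF J, of "proj_coeff A n J l"] J by (simp add: proj_coeff_eq cong: vnorm_cong)
  then show ?thesis using delta_less_1 by (simp add: field_simps)
qed

text \<open>By symmetry a column may be estimated instead of a row. It vanishes on \<open>J\<close>;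
  on \<open>S - J\<close> it is the Gram column, of norm at most b, minus an off-diagonal block of
  norm at most \<delta> applied to coefficients of norm at most b / (1 - \<delta>). The two terms
  add up to b / (1 - \<delta>).\<close>

lemma res_gram_bound:
  assumes J: "J \<subseteq> S"
  shows "vnorm S (res_gram A n J l) \<le> vnorm S (\<lambda>i. G i l) / (1 - \<delta>)"
proof -
  let ?p = "proj_coeff A n J l" and ?b = "vnorm S (\<lambda>i. G i l)"
  have "vnorm S (res_gram A n J l) = vnorm S (\<lambda>s. res_gram A n J s l)"
    using vnorm_cnj[of S "res_gram A n J l"] by (simp add: res_gram_cnj[OF J])
  also have "\<dots> = vnorm (S - J) (\<lambda>s. res_gram A n J s l)"
    unfolding vnorm_def using finite_support
    by (intro arg_cong[where f=sqrt] sum.mono_neutral_right) (auto simp: res_gram_left_zero J)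
  also have "\<dots> \<le> vnorm (S - J) (\<lambda>i. G i l) + vnorm (S - J) (\<lambda>i. \<Sum>m\<in>J. G i m * ?p m)"
    unfolding res_gram_def by (rule vnorm_triangle_diff)
  also have "\<dots> \<le> ?b + \<delta> * (?b / (1 - \<delta>))"
  proof (rule add_mono)
    show "vnorm (S - J) (\<lambda>i. G i l) \<le> ?b"
      by (rule vnorm_subset_mono[OF finite_support]) auto
    have "vnorm (S - J) (\<lambda>i. \<Sum>m\<in>J. G i m * ?p m)
        = vnorm (S - J) (\<lambda>i. (\<Sum>m\<in>J. G i m * ?p m) - (if i \<in> J then ?p i else 0))"
      by (rule vnorm_cong) auto
    also have "\<dots> \<le> vnorm S (\<lambda>i. (\<Sum>m\<in>J. G i m * ?p m) - (if i \<in> J then ?p i else 0))"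
      by (rule vnorm_subset_mono[OF finite_support]) auto
    also have "\<dots> \<le> \<delta> * vnorm J ?p" by (rule gram_diff_bound[OF J])
    also have "\<dots> \<le> \<delta> * (vnorm J (\<lambda>i. G i l) / (1 - \<delta>))"
      by (intro mult_left_mono proj_coeff_bound J delta_nonneg)
    also have "\<dots> \<le> \<delta> * (?b / (1 - \<delta>))"
      using delta_less_1 delta_nonneg
      by (intro mult_left_mono divide_right_mono vnorm_subset_mono[OF finite_support J]) auto
    finally show "vnorm (S - J) (\<lambda>i. \<Sum>m\<in>J. G i m * ?p m) \<le> \<delta> * (?b / (1 - \<delta>))" .
  qed
  also have "\<dots> = ?b / (1 - \<delta>)" using delta_less_1 by (simp add: field_simps)
  finally show ?thesis .
qed

text \<open>The diagonal entry is the unit energy of the column minus the energy of its projection.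
  Cauchy-Schwarz and the bound on the projection coefficients control the latter.\<close>

lemma res_gram_diag_bound:
  assumes J: "J \<subseteq> S" and unit: "G l l = 1"
  shows "1 - (vnorm J (\<lambda>i. G i l))\<^sup>2 / (1 - \<delta>) \<le> cmod (res_gram A n J l l)"
proof -
  let ?b = "vnorm J (\<lambda>i. G i l)"
  have "cmod (\<Sum>m\<in>J. G l m * proj_coeff A n J l m) \<le> vnorm J (\<lambda>m. G l m) * vnorm J (proj_coeff A n J l)"
    by (rule vnorm_Cauchy_Schwarz)
  also have "vnorm J (\<lambda>m. G l m) = ?b"
    using vnorm_cnj[of J "\<lambda>m. G l m"] by (simp add: gram_cnj)
  also have "?b * vnorm J (proj_coeff A n J l) \<le> ?b * (?b / (1 - \<delta>))"
    by (intro mult_left_mono proj_coeff_bound J) simp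
  finally have "cmod (\<Sum>m\<in>J. G l m * proj_coeff A n J l m) \<le> ?b\<^sup>2 / (1 - \<delta>)"
    by (simp add: power2_eq_square)
  moreover have "1 - cmod (\<Sum>m\<in>J. G l m * proj_coeff A n J l m) \<le> cmod (res_gram A n J l l)"
    unfolding res_gram_def unit using norm_triangle_ineq2[of "1::complex"] by simp
  ultimately show ?thesis by linarith
qed

text \<open>Least squares is linear and sees \<open>Y\<close> only through its correlations with the
  columns. The solution therefore combines the projection coefficients of the columns in
  \<open>S\<close> with weights \<open>X s j\<close>, and \<open>gram_injective\<close> excludes any
  other.\<close>

lemma lsq_eq:
  assumes J: "J \<subseteq> S"
    and Y: "\<And>i j. j < L \<Longrightarrow> (\<Sum>r<n. cnj (A r i) * Y r j) = (\<Sum>s\<in>S. G i s * X s j)"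
  shows "lsq A n L J Y =
    (\<lambda>i j. if i \<in> J \<and> j < L then \<Sum>s\<in>S. proj_coeff A n J s i * X s j else 0)" (is "_ = ?Z")
  unfolding lsq_def
proof (rule the_equality)
  have eq: "(\<Sum>l\<in>J. G i l * ?Z l j) = (\<Sum>r<n. cnj (A r i) * Y r j)" if "i \<in> J" "j < L" for i j
  proof -
    have "(\<Sum>l\<in>J. G i l * ?Z l j) = (\<Sum>l\<in>J. \<Sum>s\<in>S. G i l * (proj_coeff A n J s l * X s j))"
      using that by (intro sum.cong) (auto simp: sum_distrib_left)
    also have "\<dots> = (\<Sum>s\<in>S. (\<Sum>l\<in>J. G i l * proj_coeff A n J s l) * X s j)"
      by (subst sum.swap) (simp add: sum_distrib_right mult.assoc)
    also have "\<dots> = (\<Sum>s\<in>S. G i s * X s j)" using that J by (simp add: proj_coeff_eq)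
    finally show ?thesis using Y[OF \<open>j < L\<close>] by simp
  qed
  then show "(\<forall>i j. (i \<notin> J \<or> L \<le> j) \<longrightarrow> ?Z i j = 0) \<and>
    (\<forall>i\<in>J. \<forall>j<L. (\<Sum>l\<in>J. G i l * ?Z l j) = (\<Sum>r<n. cnj (A r i) * Y r j))" by simp
  fix Z
  assume Z: "(\<forall>i j. (i \<notin> J \<or> L \<le> j) \<longrightarrow> Z i j = 0) \<and>
    (\<forall>i\<in>J. \<forall>j<L. (\<Sum>l\<in>J. G i l * Z l j) = (\<Sum>r<n. cnj (A r i) * Y r j))"
  show "Z = ?Z"
  proof (intro ext)
    fix i j
    show "Z i j = ?Z i j"
    proof (cases "i \<in> J \<and> j < L")
      case True
      then show ?thesis
        using Z eq by (intro gram_injective[OF J, where v="\<lambda>i. Z i j" and w="\<lambda>i. ?Z i j"]) simp_all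
    next
      case False
      with Z have "Z i j = 0" by (simp add: not_less)
      with False show ?thesis by auto
    qed
  qed
qed

lemma corr_resid:
  assumes J: "J \<subseteq> S"
    and Y: "\<And>i j. j < L \<Longrightarrow> (\<Sum>r<n. cnj (A r i) * Y r j) = (\<Sum>s\<in>S. G i s * X s j)"
  shows "corr A n L (resid A n L J Y) l = vnorm {0..<L} (\<lambda>j. \<Sum>s\<in>S. res_gram A n J l s * X s j)"
  unfolding corr_def
proof (rule vnorm_cong)
  fix j assume "j \<in> {0..<L}"
  then have j: "j < L" by simp
  let ?p = "proj_coeff A n J"
  have "(\<Sum>r<n. cnj (A r l) * resid A n L J Y r j)
      = (\<Sum>r<n. cnj (A r l) * Y r j) - (\<Sum>r<n. \<Sum>m\<in>J. cnj (A r l) * A r m * lsq A n L J Y m j)"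
    by (simp add: resid_def right_diff_distrib sum_subtractf sum_distrib_left mult_ac)
  also have "(\<Sum>r<n. \<Sum>m\<in>J. cnj (A r l) * A r m * lsq A n L J Y m j) = (\<Sum>m\<in>J. G l m * lsq A n L J Y m j)"
    by (subst sum.swap) (simp add: gram_def sum_distrib_right)
  also have "\<dots> = (\<Sum>m\<in>J. \<Sum>s\<in>S. G l m * ?p s m * X s j)"
    using j by (simp add: lsq_eq[OF J Y] sum_distrib_left mult.assoc)
  also have "\<dots> = (\<Sum>s\<in>S. (\<Sum>m\<in>J. G l m * ?p s m) * X s j)"
    by (subst sum.swap) (simp add: sum_distrib_right)
  also have "(\<Sum>r<n. cnj (A r l) * Y r j) - \<dots> = (\<Sum>s\<in>S. res_gram A n J l s * X s j)"
    by (simp add: Y[OF j] res_gram_def left_diff_distrib sum_subtractf)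
  finally show "(\<Sum>r<n. cnj (A r l) * resid A n L J Y r j) = (\<Sum>s\<in>S. res_gram A n J l s * X s j)" .
qed

end

section \<open>A deterministic criterion for success\<close>

lemma cnj_cols_matmul:
  assumes S: "S \<subseteq> {0..<N}" and X: "\<And>s j. s \<notin> S \<Longrightarrow> X s j = 0"
  shows "(\<Sum>r<n. cnj (A r i) * matmul A N X r j) = (\<Sum>s\<in>S. gram A n i s * X s j)"
proof -
  have "matmul A N X r j = (\<Sum>s\<in>S. A r s * X s j)" for r
    unfolding matmul_def using S X by (intro sum.mono_neutral_right) auto
  then have "(\<Sum>r<n. cnj (A r i) * matmul A N X r j) = (\<Sum>r<n. \<Sum>s\<in>S. cnj (A r i) * A r s * X s j)"
    by (simp add: sum_distrib_left mult_ac)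
  also have "\<dots> = (\<Sum>s\<in>S. gram A n i s * X s j)"
    by (subst sum.swap) (simp add: gram_def sum_distrib_right)
  finally show ?thesis .
qed

lemma mu2_facts:
  assumes "finite S"
  shows mu2_nonneg: "0 \<le> mu2 A n N S"
    and mu2_outside: "l \<in> {0..<N} - S \<Longrightarrow> vnorm S (\<lambda>i. gram A n i l) \<le> mu2 A n N S"
    and mu2_inside: "l \<in> S \<Longrightarrow> vnorm (S - {l}) (\<lambda>i. gram A n i l) \<le> mu2 A n N S"
  unfolding mu2_def using assms by (auto intro!: Max_ge)

text \<open>Strict inequality makes the criterion independent of tie-breaking. Indices in
  \<open>J\<close> are among the losers, so each iteration adds a new element of \<open>S\<close>,
  and \<open>card S\<close> iterations exhaust it.\<close>

lemma somp_selectsI: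
  assumes fin: "finite S" and S: "S \<subseteq> {0..<N}"
    and step: "\<And>J. J \<subset> S \<Longrightarrow> \<exists>l\<in>S. \<forall>m<N. m \<notin> S - J \<longrightarrow>
      corr A n L (resid A n L J Y) m < corr A n L (resid A n L J Y) l"
  shows "somp_selects A n N L Y S"
  unfolding somp_selects_def
proof (intro allI impI)
  fix sel assume run: "somp_run A n N L Y (card S) sel"
  have "M \<le> card S \<Longrightarrow> sel ` {..<M} \<subseteq> S \<and> card (sel ` {..<M}) = M" for M
  proof (induction M)
    case 0
    then show ?case by simp
  next
    case (Suc M)
    let ?J = "sel ` {..<M}"
    from Suc have J: "?J \<subseteq> S" "card ?J = M" by auto
    with Suc.prems have "?J \<subset> S" by auto
    from step[OF this] obtain l where l: "l \<in> S"
      and less: "\<forall>m<N. m \<notin> S - ?J \<longrightarrow> corr A n L (resid A n L ?J Y) m < corr A n L (resid A n L ?J Y) l"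
      by blast
    have "sel M < N" "corr A n L (resid A n L ?J Y) l \<le> corr A n L (resid A n L ?J Y) (sel M)"
      using run Suc.prems l S unfolding somp_run_def by auto
    with less have "sel M \<in> S - ?J" by force
    then show ?case using J by (simp add: lessThan_Suc)
  qed
  from this[of "card S"] show "sel ` {..<card S} = S"
    using fin by (intro card_subset_eq) auto
qed


text \<open>The row of \<open>l\<close> is bounded below by its diagonal entry alone, the row of
  \<open>m\<close> above by \<open>res_gram_bound\<close>. After scaling, \<open>cond\<close> is
  exactly the comparison of these two bounds with factors 1 - \<epsilon> and 1 + \<epsilon>.\<close>

lemma residual_correlation_gap:
  fixes \<sigma> :: "nat \<Rightarrow> real"
  assumes unit_cols: "\<forall>l<N. (\<Sum>r<n. (cmod (A r l))^2) = 1"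
    and S: "S \<subseteq> {0..<N}"
    and delta: "delta A n S < 1"
    and eps: "0 < \<epsilon>" "\<epsilon> < 1"
    and cond: "((mu2 A n N S)^2 + (1 + \<epsilon>) / (1 - \<epsilon>) * mu2 A n N S) / (1 - delta A n S) \<le> 1"
    and sigma: "\<forall>s\<in>S. \<sigma> s > 0"
    and J: "J \<subset> S"
  shows "\<exists>l\<in>S. 0 < vnorm S (\<lambda>s. res_gram A n J l s * \<sigma> s) \<and>
    (\<forall>m<N. m \<notin> S \<longrightarrow> (1 + \<epsilon>) * vnorm S (\<lambda>s. res_gram A n J m s * \<sigma> s)
                      \<le> (1 - \<epsilon>) * vnorm S (\<lambda>s. res_gram A n J l s * \<sigma> s))"
proof -
  have fin: "finite S" using S finite_subset by blast
  interpret stable_support A n S using fin delta by unfold_locales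
  define R where "R = res_gram A n J"
  let ?\<mu> = "mu2 A n N S"
  have JS: "J \<subseteq> S" using J by auto
  \<comment> \<open>Choosing the largest remaining scale lets \<open>\<sigma> l\<close> be pulled
    out of every competing norm.\<close>
  have "finite (\<sigma> ` (S - J))" "\<sigma> ` (S - J) \<noteq> {}" using J fin by auto
  from Max_in[OF this] obtain l where l: "l \<in> S - J" "\<sigma> l = Max (\<sigma> ` (S - J))" by auto
  have max: "\<sigma> s \<le> \<sigma> l" if "s \<in> S - J" for s
    unfolding l(2) using that fin by (intro Max_ge) auto
  have \<sigma>l: "\<sigma> l > 0" using sigma l by auto
  have \<mu>0: "0 \<le> ?\<mu>" by (rule mu2_nonneg[OF fin])
  have 1: "1 - ?\<mu>\<^sup>2 / (1 - \<delta>) \<le> cmod (R l l)"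
  proof -
    have "G l l = of_real (\<Sum>r<n. (cmod (A r l))\<^sup>2)"
      by (simp add: gram_def complex_norm_square mult.commute del: of_real_power)
    also have "(\<Sum>r<n. (cmod (A r l))\<^sup>2) = 1" using unit_cols l S by auto
    finally have unit: "G l l = 1" by simp
    \<comment> \<open>As \<open>l\<close> is not in \<open>J\<close>, the set \<open>J\<close> lies
      inside \<open>S - {l}\<close>, where \<open>mu2\<close> controls the correlations.\<close>
    have "vnorm J (\<lambda>i. G i l) \<le> vnorm (S - {l}) (\<lambda>i. G i l)"
      using l JS fin by (intro vnorm_subset_mono) auto
    also have "\<dots> \<le> ?\<mu>" using l by (intro mu2_inside fin) auto
    finally have "(vnorm J (\<lambda>i. G i l))\<^sup>2 / (1 - \<delta>) \<le> ?\<mu>\<^sup>2 / (1 - \<delta>)"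
      using delta by (intro divide_right_mono power_mono) auto
    with res_gram_diag_bound[OF JS unit] show ?thesis by (simp add: R_def)
  qed
  have cond': "(1 + \<epsilon>) * (?\<mu> / (1 - \<delta>)) \<le> (1 - \<epsilon>) * (1 - ?\<mu>\<^sup>2 / (1 - \<delta>))"
  proof -
    have "(1 + \<epsilon>) / (1 - \<epsilon>) * (?\<mu> / (1 - \<delta>)) \<le> 1 - ?\<mu>\<^sup>2 / (1 - \<delta>)"
      using cond by (simp add: add_divide_distrib)
    then have "(1 - \<epsilon>) * ((1 + \<epsilon>) / (1 - \<epsilon>) * (?\<mu> / (1 - \<delta>))) \<le> (1 - \<epsilon>) * (1 - ?\<mu>\<^sup>2 / (1 - \<delta>))"
      using eps by (intro mult_left_mono) auto
    then show ?thesis using eps by simp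
  qed
  \<comment> \<open>For vanishing \<open>mu2\<close> the quantity is 1; otherwise
    \<open>cond'\<close> bounds it below by a positive number, up to the factor 1 -
    \<epsilon>.\<close>
  have pos: "0 < 1 - ?\<mu>\<^sup>2 / (1 - \<delta>)"
  proof (cases "?\<mu> = 0")
    case False
    then have "0 < (1 + \<epsilon>) * (?\<mu> / (1 - \<delta>))" using \<mu>0 delta eps by simp
    with cond' have "0 < (1 - \<epsilon>) * (1 - ?\<mu>\<^sup>2 / (1 - \<delta>))" by linarith
    then show ?thesis using eps by (simp add: zero_less_mult_iff)
  qed simp
  have low: "\<sigma> l * (1 - ?\<mu>\<^sup>2 / (1 - \<delta>)) \<le> vnorm S (\<lambda>s. R l s * \<sigma> s)"
  proof -
    have "\<sigma> l * (1 - ?\<mu>\<^sup>2 / (1 - \<delta>)) \<le> \<sigma> l * cmod (R l l)"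
      using 1 \<sigma>l by (intro mult_left_mono) auto
    also have "\<dots> = cmod (R l l * \<sigma> l)" using \<sigma>l by (simp add: norm_mult)
    also have "\<dots> \<le> vnorm S (\<lambda>s. R l s * \<sigma> s)"
      using l by (intro cmod_le_vnorm[OF fin]) auto
    finally show ?thesis .
  qed
  have "(1 + \<epsilon>) * vnorm S (\<lambda>s. R m s * \<sigma> s) \<le> (1 - \<epsilon>) * vnorm S (\<lambda>s. R l s * \<sigma> s)"
    if m: "m < N" "m \<notin> S" for m
  proof -
    have "vnorm S (\<lambda>s. R m s * \<sigma> s) \<le> vnorm S (\<lambda>s. complex_of_real (\<sigma> l) * R m s)"
    proof (rule vnorm_mono)
      fix s assume s: "s \<in> S"
      show "cmod (R m s * \<sigma> s) \<le> cmod (complex_of_real (\<sigma> l) * R m s)"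
      \<comment> \<open>Scales on \<open>J\<close> may exceed \<open>\<sigma> l\<close>, but the
        residual entries vanish there.\<close>
      proof (cases "s \<in> J")
        case True
        then show ?thesis by (simp add: R_def res_gram_right_zero[OF JS])
      next
        case False
        then have "\<sigma> s \<le> \<sigma> l" "0 < \<sigma> s" using s max sigma by auto
        then show ?thesis by (simp add: norm_mult mult.commute mult_right_mono)
      qed
    qed
    also have "\<dots> = \<sigma> l * vnorm S (R m)" using \<sigma>l by (simp add: vnorm_scale)
    also have "\<dots> \<le> \<sigma> l * (vnorm S (\<lambda>i. G i m) / (1 - \<delta>))"
      unfolding R_def using \<sigma>l by (intro mult_left_mono res_gram_bound JS) auto
    also have "\<dots> \<le> \<sigma> l * (?\<mu> / (1 - \<delta>))"
      using \<sigma>l m delta by (intro mult_left_mono divide_right_mono mu2_outside fin) auto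
    finally have "(1 + \<epsilon>) * vnorm S (\<lambda>s. R m s * \<sigma> s) \<le> (1 + \<epsilon>) * (\<sigma> l * (?\<mu> / (1 - \<delta>)))"
      using eps by (intro mult_left_mono) auto
    also have "\<dots> = \<sigma> l * ((1 + \<epsilon>) * (?\<mu> / (1 - \<delta>)))" by simp
    also have "\<dots> \<le> \<sigma> l * ((1 - \<epsilon>) * (1 - ?\<mu>\<^sup>2 / (1 - \<delta>)))"
      using \<sigma>l by (intro mult_left_mono cond') auto
    also have "\<dots> = (1 - \<epsilon>) * (\<sigma> l * (1 - ?\<mu>\<^sup>2 / (1 - \<delta>)))" by simp
    also have "\<dots> \<le> (1 - \<epsilon>) * vnorm S (\<lambda>s. R l s * \<sigma> s)"
      using eps by (intro mult_left_mono low) auto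
    finally show ?thesis .
  qed
  moreover have "0 < vnorm S (\<lambda>s. R l s * \<sigma> s)"
    using low mult_pos_pos[OF \<sigma>l pos] by linarith
  ultimately show ?thesis using l unfolding R_def by blast
qed

section \<open>Chernoff bounds for chi-square tails\<close>

text \<open>With x = K / 2, log-convexity of Gamma at the midpoint of x and x + 1, together with
  Gamma(x + 1) = x Gamma(x), bounds Gamma(x + 1/2)^2 by x Gamma(x)^2.\<close>

lemma A_const_square_le:
  assumes "K > 0"
  shows "(A_const K)\<^sup>2 \<le> real K"
proof -
  define x where "x = real K / 2"
  have x: "x > 0" using assms by (simp add: x_def)
  have "(ln \<circ> Gamma) ((1 - 1/2) *\<^sub>R x + (1/2) *\<^sub>R (x + 1))
      \<le> (1 - 1/2) * (ln \<circ> Gamma) x + (1/2) * (ln \<circ> Gamma :: real \<Rightarrow> real) (x + 1)"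
    using x by (intro convex_onD[OF log_convex_Gamma_real]) auto
  also have "(1 - 1/2) *\<^sub>R x + (1/2) *\<^sub>R (x + 1) = x + 1/2" by (simp add: field_simps)
  finally have "2 * ln (Gamma (x + 1/2)) \<le> ln (Gamma x) + ln (Gamma (x + 1))" by simp
  moreover have pos: "Gamma x > 0" "Gamma (x + 1) > 0" "Gamma (x + 1/2) > 0"
    using x by (auto intro: Gamma_real_pos)
  ultimately have "ln ((Gamma (x + 1/2))\<^sup>2) \<le> ln (Gamma x * Gamma (x + 1))"
    by (simp add: ln_mult ln_realpow)
  then have "(Gamma (x + 1/2))\<^sup>2 \<le> Gamma x * Gamma (x + 1)"
    using pos by (subst (asm) ln_le_cancel_iff) auto
  also have "Gamma (x + 1) = x * Gamma x"
    using x by (intro Gamma_plus1) (auto simp: nonpos_Ints_def)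
  finally have le: "(Gamma (x + 1/2))\<^sup>2 \<le> x * (Gamma x)\<^sup>2" by (simp add: power2_eq_square mult_ac)
  have "(real K + 1) / 2 = x + 1/2" by (simp add: x_def)
  then have "A_const K = sqrt 2 * Gamma (x + 1/2) / Gamma x"
    by (simp only: A_const_def) (simp add: x_def)
  then have "(A_const K)\<^sup>2 = 2 * (Gamma (x + 1/2))\<^sup>2 / (Gamma x)\<^sup>2"
    by (simp add: power_divide power_mult_distrib)
  also have "\<dots> \<le> 2 * x" using le pos by (simp add: divide_simps mult_ac)
  finally show ?thesis by (simp add: x_def)
qed

text \<open>The derivative 1 / (1 - y^2) of artanh is at least 1.\<close>

lemma artanh_ge_self:
  assumes "0 \<le> x" "x < 1"
  shows "x \<le> artanh (x::real)"
proof -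
  have "artanh 0 - 0 \<le> artanh x - x"
  proof (rule DERIV_nonneg_imp_nondecreasing[OF assms(1)])
    fix y assume y: "0 \<le> y" "y \<le> x"
    then have "\<bar>y\<bar> < 1" "1 - y\<^sup>2 > 0" "1 - y\<^sup>2 \<le> 1"
      using assms by (auto simp: abs_square_less_1 power_less_one_iff)
    then show "\<exists>D. ((\<lambda>y. artanh y - y) has_real_derivative D) (at y) \<and> 0 \<le> D"
      by (intro exI[of _ "1 / (1 - y\<^sup>2) - 1"] conjI) (auto intro!: derivative_eq_intros simp: field_simps)
  qed
  then show ?thesis by simp
qed

text \<open>This is ln z <= z - 1 at z = (1 + x) / (1 - x).\<close>

lemma artanh_le:
  assumes "0 \<le> x" "x < 1"
  shows "artanh (x::real) \<le> x / (1 - x)"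
proof -
  have "ln ((1 + x) / (1 - x)) \<le> (1 + x) / (1 - x) - 1"
    using assms by (intro ln_le_minus_one) auto
  then show ?thesis using assms by (simp add: artanh_def field_simps)
qed

text \<open>At the common scale \<open>\<gamma> = artanh \<epsilon> / \<epsilon>\<close> the Chernoff exponents \<open>x - 1 - ln x\<close> at
  \<open>x = (1 + \<epsilon>)\<^sup>2 \<gamma>\<close> and \<open>x = (1 - \<epsilon>)\<^sup>2 \<gamma>\<close> coincide.\<close>

lemma balanced_exponents:
  fixes \<epsilon> :: real
  assumes eps: "0 < \<epsilon>" "\<epsilon> < 1"
  defines "\<gamma> \<equiv> artanh \<epsilon> / \<epsilon>"
  shows "1 \<le> \<gamma>" "1 < (1 + \<epsilon>)\<^sup>2 * \<gamma>" "(1 - \<epsilon>)\<^sup>2 * \<gamma> < 1"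
    and "2 * \<epsilon>\<^sup>2 \<le> (1 + \<epsilon>)\<^sup>2 * \<gamma> - 1 - ln ((1 + \<epsilon>)\<^sup>2 * \<gamma>)"
    and "2 * \<epsilon>\<^sup>2 \<le> (1 - \<epsilon>)\<^sup>2 * \<gamma> - 1 - ln ((1 - \<epsilon>)\<^sup>2 * \<gamma>)"
proof -
  show \<gamma>1: "1 \<le> \<gamma>" using artanh_ge_self[of \<epsilon>] eps by (simp add: \<gamma>_def)
  have "1 < (1 + \<epsilon>)\<^sup>2" using eps by simp
  then show "1 < (1 + \<epsilon>)\<^sup>2 * \<gamma>" using \<gamma>1 by (simp add: less_le_trans[OF _ mult_left_mono, of 1 _ 1])
  have "\<gamma> \<le> 1 / (1 - \<epsilon>)" using artanh_le[of \<epsilon>] eps by (simp add: \<gamma>_def field_simps)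
  then have "(1 - \<epsilon>)\<^sup>2 * \<gamma> \<le> (1 - \<epsilon>)\<^sup>2 * (1 / (1 - \<epsilon>))" by (intro mult_left_mono) auto
  also have "\<dots> < 1" using eps by (simp add: power2_eq_square)
  finally show "(1 - \<epsilon>)\<^sup>2 * \<gamma> < 1" .
  \<comment> \<open>This identity balances the tails: in both exponents the terms odd in \<epsilon>
    cancel, leaving (\<gamma> - 1 - ln \<gamma>) + \<epsilon>^2 \<gamma> - ln (1 - \<epsilon>^2).
    The first part is nonnegative and each of the other two is at least \<epsilon>^2.\<close>
  have art: "2 * \<epsilon> * \<gamma> = ln (1 + \<epsilon>) - ln (1 - \<epsilon>)"
    using eps by (simp add: \<gamma>_def artanh_def ln_div)
  have "ln ((1 + \<epsilon>) * (1 - \<epsilon>)) = ln (1 + \<epsilon>) + ln (1 - \<epsilon>)" using eps by (intro ln_mult_pos) auto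
  moreover have "ln ((1 + \<epsilon>) * (1 - \<epsilon>)) \<le> (1 + \<epsilon>) * (1 - \<epsilon>) - 1"
    using eps by (intro ln_le_minus_one) auto
  ultimately have 1: "ln (1 + \<epsilon>) + ln (1 - \<epsilon>) \<le> - \<epsilon>\<^sup>2" by (simp add: algebra_simps power2_eq_square)
  have 2: "ln \<gamma> \<le> \<gamma> - 1" using \<gamma>1 by (intro ln_le_minus_one) auto
  have 3: "\<epsilon>\<^sup>2 \<le> \<epsilon>\<^sup>2 * \<gamma>" using \<gamma>1 mult_left_mono[of 1 \<gamma> "\<epsilon>\<^sup>2"] by simp
  have "ln ((1 + \<epsilon>)\<^sup>2 * \<gamma>) = 2 * ln (1 + \<epsilon>) + ln \<gamma>"
    using eps \<gamma>1 by (simp add: ln_mult ln_realpow)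
  moreover have "(1 + \<epsilon>)\<^sup>2 * \<gamma> = \<gamma> + 2 * \<epsilon> * \<gamma> + \<epsilon>\<^sup>2 * \<gamma>" by (simp add: algebra_simps power2_eq_square)
  ultimately show "2 * \<epsilon>\<^sup>2 \<le> (1 + \<epsilon>)\<^sup>2 * \<gamma> - 1 - ln ((1 + \<epsilon>)\<^sup>2 * \<gamma>)"
    using art 1 2 3 by linarith
  have "ln ((1 - \<epsilon>)\<^sup>2 * \<gamma>) = 2 * ln (1 - \<epsilon>) + ln \<gamma>"
    using eps \<gamma>1 by (simp add: ln_mult ln_realpow)
  moreover have "(1 - \<epsilon>)\<^sup>2 * \<gamma> = \<gamma> - 2 * \<epsilon> * \<gamma> + \<epsilon>\<^sup>2 * \<gamma>" by (simp add: algebra_simps power2_eq_square)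
  ultimately show "2 * \<epsilon>\<^sup>2 \<le> (1 - \<epsilon>)\<^sup>2 * \<gamma> - 1 - ln ((1 - \<epsilon>)\<^sup>2 * \<gamma>)"
    using art 1 2 3 by linarith
qed

text \<open>The optimal parameter \<open>t\<close> satisfies \<open>1 - 2 t v = 1 / x\<close>; it is positive for \<open>x > 1\<close>
  (upper tail) and negative for \<open>x < 1\<close> (lower tail), so one statement covers both.\<close>

lemma (in prob_space) chi_square_Chernoff:
  fixes W :: "'a \<Rightarrow> real"
  assumes [measurable]: "random_variable borel W" and v: "v > 0" and x: "x > 0"
    and mgf: "\<And>t. 2 * t * v < 1 \<Longrightarrow>
      (\<integral>\<^sup>+\<omega>. ennreal (exp (t * W \<omega>)) \<partial>M) \<le> ennreal ((1 - 2 * t * v) powr (- (K / 2)))"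
    and meas: "{\<omega> \<in> space M. P \<omega>} \<in> events"
    and P: "\<And>\<omega>. \<omega> \<in> space M \<Longrightarrow> P \<omega> \<Longrightarrow> 0 \<le> (x - 1) * (W \<omega> - x * K * v)"
  shows "prob {\<omega> \<in> space M. P \<omega>} \<le> exp (- (K / 2 * (x - 1 - ln x)))"
proof -
  define t where "t = (1 - 1 / x) / (2 * v)"
  have tv: "1 - 2 * t * v = 1 / x" using v by (simp add: t_def field_simps)
  have tv_less: "2 * t * v < 1" using tv divide_pos_pos[OF zero_less_one x] by linarith
  \<comment> \<open>Since \<open>t\<close> has the sign of \<open>x - 1\<close>, hypothesis
    \<open>P\<close> makes \<open>t * (W \<omega> - x * K * v)\<close> nonnegative on the event, so
    its indicator is dominated by the exponential.\<close>
  have t: "t = (x - 1) * (1 / (2 * v * x))" using v x by (simp add: t_def field_simps)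
  have "emeasure M {\<omega> \<in> space M. P \<omega>} = (\<integral>\<^sup>+\<omega>. indicator {\<omega> \<in> space M. P \<omega>} \<omega> \<partial>M)"
    using meas by simp
  also have "\<dots> \<le> (\<integral>\<^sup>+\<omega>. ennreal (exp (- t * (x * K * v))) * ennreal (exp (t * W \<omega>)) \<partial>M)"
  proof (rule nn_integral_mono)
    fix \<omega> assume \<omega>: "\<omega> \<in> space M"
    show "indicator {\<omega> \<in> space M. P \<omega>} \<omega> \<le> ennreal (exp (- t * (x * K * v))) * ennreal (exp (t * W \<omega>))"
    proof (cases "P \<omega>")
      case True
      have "0 \<le> (1 / (2 * v * x)) * ((x - 1) * (W \<omega> - x * K * v))"
        using v x by (intro mult_nonneg_nonneg[OF _ P[OF \<omega> True]]) auto
      also have "\<dots> = t * (W \<omega> - x * K * v)" by (simp add: t)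
      also have "\<dots> = - t * (x * K * v) + t * W \<omega>" by (simp add: algebra_simps)
      finally have "1 \<le> exp (- t * (x * K * v)) * exp (t * W \<omega>)" by (simp flip: exp_add)
      then show ?thesis using True \<omega> by (simp add: ennreal_1[symmetric] ennreal_leI flip: ennreal_mult' del: ennreal_1)
    qed simp
  qed
  also have "\<dots> = ennreal (exp (- t * (x * K * v))) * (\<integral>\<^sup>+\<omega>. ennreal (exp (t * W \<omega>)) \<partial>M)"
    by (rule nn_integral_cmult) simp
  also have "\<dots> \<le> ennreal (exp (- t * (x * K * v))) * ennreal ((1 - 2 * t * v) powr (- (K / 2)))"
    by (intro mult_left_mono mgf tv_less) auto
  also have "\<dots> = ennreal (exp (- t * (x * K * v)) * (1 / x) powr (- (K / 2)))"
    by (simp add: ennreal_mult' tv)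
  also have "(1 / x) powr (- (K / 2)) = exp (K / 2 * ln x)"
    using x by (simp add: powr_def ln_div)
  also have "exp (- t * (x * K * v)) * exp (K / 2 * ln x) = exp (- (K / 2 * (x - 1 - ln x)))"
  proof -
    have "t * (x * K * v) = K / 2 * (x - 1)" using v x by (simp add: t field_simps)
    then show ?thesis by (simp add: algebra_simps flip: exp_add)
  qed
  finally show ?thesis by (simp add: emeasure_eq_measure)
qed

section \<open>Moment generating functions of Gaussian matrices\<close>

text \<open>Completing the square, with q = 1 - 2 s, turns the integrand into a constant times the
  normal density of mean 2 s a / q and variance 1 / q.\<close>

lemma nn_integral_exp_square_std_normal:
  fixes s a :: real
  assumes s: "2 * s < 1"
  shows "(\<integral>\<^sup>+x. ennreal (std_normal_density x) * ennreal (exp (s * (a + x)\<^sup>2)) \<partial>lborel)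
       = ennreal ((1 - 2 * s) powr (- (1/2)) * exp (s * a\<^sup>2 / (1 - 2 * s)))"
proof -
  define q where "q = 1 - 2 * s"
  have q: "q > 0" using s by (simp add: q_def)
  define C where "C = q powr (- (1/2)) * exp (s * a\<^sup>2 / q)"
  have C: "C \<ge> 0" by (simp add: C_def)
  have "std_normal_density x * exp (s * (a + x)\<^sup>2) = C * normal_density (2 * s * a / q) (1 / sqrt q) x" for x
  proof -
    have e: "- x\<^sup>2 / 2 + s * (a + x)\<^sup>2 = s * a\<^sup>2 / q + - (x - 2 * s * a / q)\<^sup>2 / (2 * (1 / sqrt q)\<^sup>2)"
    proof -
      define B where "B = (q * x - 2 * s * a)\<^sup>2"
      have "q * (- x\<^sup>2 / 2 + s * (a + x)\<^sup>2) = s * a\<^sup>2 - B / 2"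
        by (simp add: B_def q_def field_simps power2_eq_square)
      then have "- x\<^sup>2 / 2 + s * (a + x)\<^sup>2 = (s * a\<^sup>2 - B / 2) / q"
        using q by (metis less_numeral_extra(3) nonzero_mult_div_cancel_left)
      moreover have "(x - 2 * s * a / q)\<^sup>2 = B / q\<^sup>2"
        using q by (simp add: B_def field_simps flip: power_divide)
      ultimately show ?thesis
        using q by (simp add: power_divide diff_divide_distrib power2_eq_square)
    qed
    have k: "1 / sqrt (2 * pi) = q powr (- (1/2)) * (1 / sqrt (2 * pi * (1 / sqrt q)\<^sup>2))"
      using q by (simp add: powr_minus powr_half_sqrt real_sqrt_divide power_divide field_simps)
    have "std_normal_density x * exp (s * (a + x)\<^sup>2) = 1 / sqrt (2 * pi) * exp (- x\<^sup>2 / 2 + s * (a + x)\<^sup>2)"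
      by (simp only: std_normal_density_def exp_add mult.assoc)
    also have "\<dots> = C * normal_density (2 * s * a / q) (1 / sqrt q) x"
      unfolding e k normal_density_def C_def exp_add by (simp only: mult_ac)
    finally show ?thesis .
  qed
  then have "(\<integral>\<^sup>+x. ennreal (std_normal_density x) * ennreal (exp (s * (a + x)\<^sup>2)) \<partial>lborel)
      = (\<integral>\<^sup>+x. ennreal C * ennreal (normal_density (2 * s * a / q) (1 / sqrt q) x) \<partial>lborel)"
    using C by (simp flip: ennreal_mult')
  also have "\<dots> = ennreal C * (\<integral>\<^sup>+x. ennreal (normal_density (2 * s * a / q) (1 / sqrt q) x) \<partial>lborel)"
    by (rule nn_integral_cmult) simp
  also have "(\<integral>\<^sup>+x. ennreal (normal_density (2 * s * a / q) (1 / sqrt q) x) \<partial>lborel) = 1"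
    using q by (subst nn_integral_eq_integral) auto
  finally show ?thesis by (simp add: C_def q_def)
qed

text \<open>The standard normal law on \<open>real\<close> has this property for \<open>\<kappa> = 1\<close>; the law of \<open>X + \<i> Y\<close> with
  \<open>X\<close>, \<open>Y\<close> independent standard normal has it for \<open>\<kappa> = 2\<close>.\<close>

definition quadratic_mgf :: "real \<Rightarrow> 'b::real_normed_field measure \<Rightarrow> bool" where
  "quadratic_mgf \<kappa> P \<longleftrightarrow> (\<forall>a u t. 2 * t * (norm u)\<^sup>2 < 1 \<longrightarrow>
     (\<integral>\<^sup>+y. ennreal (exp (t * (norm (a + u * y))\<^sup>2)) \<partial>P)
       = ennreal ((1 - 2 * t * (norm u)\<^sup>2) powr (- (\<kappa> / 2)) * exp (t * (norm a)\<^sup>2 / (1 - 2 * t * (norm u)\<^sup>2))))"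

lemma quadratic_mgfD:
  assumes "quadratic_mgf \<kappa> P" "2 * t * (norm u)\<^sup>2 < 1"
  shows "(\<integral>\<^sup>+y. ennreal (exp (t * (norm (a + u * y))\<^sup>2)) \<partial>P)
    = ennreal ((1 - 2 * t * (norm u)\<^sup>2) powr (- (\<kappa> / 2)) * exp (t * (norm a)\<^sup>2 / (1 - 2 * t * (norm u)\<^sup>2)))"
  using assms by (simp add: quadratic_mgf_def)

text \<open>The norm is multiplicative, so a nonzero \<open>u\<close> factors out, leaving offset
  \<open>a / u\<close> and parameter t |u|^2. For \<open>u = 0\<close> the integrand is
  constant.\<close>

lemma quadratic_mgfI:
  fixes P :: "'b::real_normed_field measure"
  assumes P: "prob_space P"
    and translate: "\<And>a s. 2 * s < 1 \<Longrightarrow> (\<integral>\<^sup>+y. ennreal (exp (s * (norm (a + y))\<^sup>2)) \<partial>P)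
       = ennreal ((1 - 2 * s) powr (- (\<kappa> / 2)) * exp (s * (norm a)\<^sup>2 / (1 - 2 * s)))"
  shows "quadratic_mgf \<kappa> P"
  unfolding quadratic_mgf_def
proof (intro allI impI)
  fix a u :: 'b and t :: real assume t: "2 * t * (norm u)\<^sup>2 < 1"
  interpret prob_space P by fact
  show "(\<integral>\<^sup>+y. ennreal (exp (t * (norm (a + u * y))\<^sup>2)) \<partial>P)
       = ennreal ((1 - 2 * t * (norm u)\<^sup>2) powr (- (\<kappa> / 2)) * exp (t * (norm a)\<^sup>2 / (1 - 2 * t * (norm u)\<^sup>2)))"
  proof (cases "u = 0")
    case True
    then show ?thesis by (simp add: emeasure_space_1)
  next
    case False
    have eq: "t * (norm (a + u * y))\<^sup>2 = t * (norm u)\<^sup>2 * (norm (a / u + y))\<^sup>2" for y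
    proof -
      have "a + u * y = u * (a / u + y)" using False by (simp add: field_simps)
      then show ?thesis by (simp add: norm_mult power_mult_distrib)
    qed
    have eq0: "t * (norm u)\<^sup>2 * (norm (a / u))\<^sup>2 = t * (norm a)\<^sup>2"
      using False by (simp add: norm_divide power_divide)
    show ?thesis
      using translate[of "t * (norm u)\<^sup>2" "a / u"] t unfolding eq eq0 by (simp add: mult.assoc)
  qed
qed

text \<open>Integrating out one coordinate, with the remaining partial sum as offset, reproduces the
  same integrand with \<open>t / q\<close> in place of \<open>t\<close>. Hence the induction is over
  all \<open>t\<close>.\<close>

lemma quadratic_mgf_PiM:
  fixes P :: "'i \<Rightarrow> 'b::{real_normed_field,second_countable_topology} measure"
  assumes prob: "\<And>i. prob_space (P i)" and sets: "\<And>i. sets (P i) = sets borel"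
    and "finite J" and mgf: "\<And>i. i \<in> J \<Longrightarrow> quadratic_mgf \<kappa> (P i)"
    and "2 * t * (\<Sum>i\<in>J. (norm (u i))\<^sup>2) < 1"
  shows "(\<integral>\<^sup>+x. ennreal (exp (t * (norm (a + (\<Sum>i\<in>J. u i * x i)))\<^sup>2)) \<partial>PiM J P)
    = ennreal ((1 - 2 * t * (\<Sum>i\<in>J. (norm (u i))\<^sup>2)) powr (- (\<kappa> / 2))
        * exp (t * (norm a)\<^sup>2 / (1 - 2 * t * (\<Sum>i\<in>J. (norm (u i))\<^sup>2))))"
  using assms(3-)
proof (induction J arbitrary: t rule: finite_induct)
  case empty
  show ?case by (simp add: space_PiM)
next
  case (insert i J)
  interpret product_sigma_finite P
    using prob by (intro product_sigma_finite.intro prob_space_imp_sigma_finite)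
  note [measurable_cong] = sets
  let ?N = "\<Sum>j\<in>J. (norm (u j))\<^sup>2"
  define D where "D = 1 - 2 * t * (\<Sum>i\<in>insert i J. (norm (u i))\<^sup>2)"
  define q where "q = 1 - 2 * t * (norm (u i))\<^sup>2"
  have D: "D > 0" using insert.prems by (simp add: D_def)
  have Dq: "D = q - 2 * t * ?N" using insert.hyps by (simp add: D_def q_def algebra_simps)
  have N: "0 \<le> ?N" by (intro sum_nonneg) simp
  \<comment> \<open>For \<open>t\<close> nonnegative, \<open>q\<close> is at least \<open>D\<close>;
    for \<open>t\<close> negative, it is at least 1.\<close>
  have q: "q > 0"
  proof (cases "t \<ge> 0")
    case True
    then have "0 \<le> 2 * t * ?N" using N by simp
    then show ?thesis using D Dq by linarith
  next
    case False
    then have "2 * t * (norm (u i))\<^sup>2 \<le> 0" by (simp add: mult_nonpos_nonneg)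
    then show ?thesis by (simp add: q_def)
  qed
  have tq: "1 - 2 * (t / q) * ?N = D / q" using q by (simp add: Dq field_simps)
  have "(\<integral>\<^sup>+x. ennreal (exp (t * (norm (a + (\<Sum>i\<in>insert i J. u i * x i)))\<^sup>2)) \<partial>PiM (insert i J) P)
    = (\<integral>\<^sup>+x. (\<integral>\<^sup>+y. ennreal (exp (t * (norm (a + (\<Sum>k\<in>insert i J. u k * (x(i := y)) k)))\<^sup>2)) \<partial>P i) \<partial>PiM J P)"
    using insert.hyps by (intro product_nn_integral_insert) measurable
  also have "\<dots> = (\<integral>\<^sup>+x. ennreal (q powr (- (\<kappa> / 2))) *
      ennreal (exp (t / q * (norm (a + (\<Sum>j\<in>J. u j * x j)))\<^sup>2)) \<partial>PiM J P)"
  proof (intro nn_integral_cong)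
    fix x
    have "(\<Sum>k\<in>insert i J. u k * (x(i := y)) k) = u i * y + (\<Sum>j\<in>J. u j * x j)" for y
      using insert.hyps by (auto intro!: sum.cong)
    then have eq: "a + (\<Sum>k\<in>insert i J. u k * (x(i := y)) k) = a + (\<Sum>j\<in>J. u j * x j) + u i * y" for y
      by simp
    have "2 * t * (norm (u i))\<^sup>2 < 1" using q by (simp add: q_def)
    from quadratic_mgfD[OF insert.prems(1)[of i] this]
    show "(\<integral>\<^sup>+y. ennreal (exp (t * (norm (a + (\<Sum>k\<in>insert i J. u k * (x(i := y)) k)))\<^sup>2)) \<partial>P i)
      = ennreal (q powr (- (\<kappa> / 2))) * ennreal (exp (t / q * (norm (a + (\<Sum>j\<in>J. u j * x j)))\<^sup>2))"
      unfolding eq by (simp add: q_def flip: ennreal_mult')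
  qed
  also have "\<dots> = ennreal (q powr (- (\<kappa> / 2))) *
      (\<integral>\<^sup>+x. ennreal (exp (t / q * (norm (a + (\<Sum>j\<in>J. u j * x j)))\<^sup>2)) \<partial>PiM J P)"
    by (rule nn_integral_cmult) measurable
  also have "(\<integral>\<^sup>+x. ennreal (exp (t / q * (norm (a + (\<Sum>j\<in>J. u j * x j)))\<^sup>2)) \<partial>PiM J P)
      = ennreal ((D / q) powr (- (\<kappa> / 2)) * exp (t / q * (norm a)\<^sup>2 / (D / q)))"
  proof -
    have "2 * (t / q) * ?N < 1" using tq divide_pos_pos[OF D q] by linarith
    from insert.IH[OF _ this] insert.prems(1) show ?thesis by (simp only: tq insertI2)
  qed
  also have "ennreal (q powr (- (\<kappa> / 2))) * \<dots> = ennreal (D powr (- (\<kappa> / 2)) * exp (t * (norm a)\<^sup>2 / D))"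
    using q D by (simp add: powr_divide flip: ennreal_mult')
  finally show ?case by (simp only: D_def)
qed

lemma (in prob_space) quadratic_mgf_sum:
  fixes Z :: "'i \<Rightarrow> 'a \<Rightarrow> 'b::{real_normed_field,second_countable_topology}"
  assumes fin: "finite J" and indep: "indep_vars (\<lambda>_. borel) Z J"
    and mgf: "\<And>i. i \<in> J \<Longrightarrow> quadratic_mgf \<kappa> (distr M borel (Z i))"
    and t: "2 * t * (\<Sum>i\<in>J. (norm (u i))\<^sup>2) < 1"
  shows "(\<integral>\<^sup>+\<omega>. ennreal (exp (t * (norm (\<Sum>i\<in>J. u i * Z i \<omega>))\<^sup>2)) \<partial>M)
    = ennreal ((1 - 2 * t * (\<Sum>i\<in>J. (norm (u i))\<^sup>2)) powr (- (\<kappa> / 2)))"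
proof (cases "J = {}")
  case True
  then show ?thesis by (simp add: emeasure_space_1)
next
  case False
  have rv: "random_variable borel (Z i)" if "i \<in> J" for i
    using indep that by (auto simp: indep_vars_def)
  \<comment> \<open>The product lemma asks for a probability measure at every index; a point mass
    fills the places outside \<open>J\<close>.\<close>
  define P where "P i = (if i \<in> J then distr M borel (Z i) else return borel 0)" for i
  have "(\<integral>\<^sup>+\<omega>. ennreal (exp (t * (norm (\<Sum>i\<in>J. u i * Z i \<omega>))\<^sup>2)) \<partial>M)
    = (\<integral>\<^sup>+x. ennreal (exp (t * (norm (\<Sum>i\<in>J. u i * x i))\<^sup>2)) \<partial>distr M (PiM J (\<lambda>_. borel)) (\<lambda>\<omega>. \<lambda>i\<in>J. Z i \<omega>))"
    by (subst nn_integral_distr) (auto intro!: measurable_restrict rv)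
  also have "distr M (PiM J (\<lambda>_. borel)) (\<lambda>\<omega>. \<lambda>i\<in>J. Z i \<omega>) = PiM J (\<lambda>i. distr M borel (Z i))"
    using indep_vars_iff_distr_eq_PiM'[OF False, of Z "\<lambda>_. borel"] rv indep by simp
  also have "\<dots> = PiM J P" by (intro PiM_cong) (auto simp: P_def)
  also have "(\<integral>\<^sup>+x. ennreal (exp (t * (norm (\<Sum>i\<in>J. u i * x i))\<^sup>2)) \<partial>PiM J P)
      = ennreal ((1 - 2 * t * (\<Sum>i\<in>J. (norm (u i))\<^sup>2)) powr (- (\<kappa> / 2)))"
    using quadratic_mgf_PiM[of P J \<kappa> t u 0] fin mgf t rv
    by (simp add: P_def prob_space_distr prob_space_return)
  finally show ?thesis .
qed

text \<open>Different columns use the disjoint index blocks \<open>S \<times> {j}\<close>, so the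
  exponential of the sum splits into independent factors with equal integrals.\<close>

lemma (in prob_space) quadratic_mgf_columns:
  fixes Z :: "nat \<Rightarrow> nat \<Rightarrow> 'a \<Rightarrow> 'b::{real_normed_field,second_countable_topology}"
  assumes fin: "finite S" and indep: "indep_vars (\<lambda>_. borel) (\<lambda>(s, j). Z s j) (S \<times> {0..<L})"
    and mgf: "\<And>s j. s \<in> S \<Longrightarrow> j < L \<Longrightarrow> quadratic_mgf \<kappa> (distr M borel (Z s j))"
    and t: "2 * t * (\<Sum>s\<in>S. (norm (u s))\<^sup>2) < 1"
  shows "(\<integral>\<^sup>+\<omega>. ennreal (exp (t * (\<Sum>j=0..<L. (norm (\<Sum>s\<in>S. u s * Z s j \<omega>))\<^sup>2))) \<partial>M)
    = ennreal ((1 - 2 * t * (\<Sum>s\<in>S. (norm (u s))\<^sup>2)) powr (- (\<kappa> * L / 2)))"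
proof -
  let ?Z = "\<lambda>(s, j). Z s j" and ?D = "1 - 2 * t * (\<Sum>s\<in>S. (norm (u s))\<^sup>2)"
  have sum_col: "(\<Sum>i\<in>S \<times> {j}. f i) = (\<Sum>s\<in>S. f (s, j))" for f :: "nat \<times> nat \<Rightarrow> 'c::comm_monoid_add" and j
    by (intro sum.reindex_cong[of "\<lambda>s. (s, j)"]) (auto simp: inj_on_def)
  define g where "g j x = ennreal (exp (t * (norm (\<Sum>i\<in>S \<times> {j}. u (fst i) * x i))\<^sup>2))" for j and x :: "nat \<times> nat \<Rightarrow> 'b"
  have "indep_vars (\<lambda>j. PiM (S \<times> {j}) (\<lambda>_. borel)) (\<lambda>j \<omega>. restrict (\<lambda>i. ?Z i \<omega>) (S \<times> {j})) {0..<L}"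
    by (rule indep_vars_restrict[OF indep]) (auto simp: disjoint_family_on_def)
  then have ind: "indep_vars (\<lambda>_. borel) (\<lambda>j \<omega>. g j (restrict (\<lambda>i. ?Z i \<omega>) (S \<times> {j}))) {0..<L}"
    by (rule indep_vars_compose2) (simp add: g_def)
  have g: "g j (restrict (\<lambda>i. ?Z i \<omega>) (S \<times> {j})) = ennreal (exp (t * (norm (\<Sum>i\<in>S \<times> {j}. u (fst i) * ?Z i \<omega>))\<^sup>2))" for j \<omega>
    unfolding g_def by (simp cong: sum.cong)
  have col: "(\<integral>\<^sup>+\<omega>. g j (restrict (\<lambda>i. ?Z i \<omega>) (S \<times> {j})) \<partial>M) = ennreal (?D powr (- (\<kappa> / 2)))"
    if j: "j < L" for j
  proof -
    have "indep_vars (\<lambda>_. borel) ?Z (S \<times> {j})"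
      by (rule indep_vars_subset[OF indep]) (use j in auto)
    then have "(\<integral>\<^sup>+\<omega>. g j (restrict (\<lambda>i. ?Z i \<omega>) (S \<times> {j})) \<partial>M)
      = ennreal ((1 - 2 * t * (\<Sum>i\<in>S \<times> {j}. (norm (u (fst i)))\<^sup>2)) powr (- (\<kappa> / 2)))"
      unfolding g using fin mgf t j by (intro quadratic_mgf_sum) (auto simp: sum_col)
    then show ?thesis by (simp add: sum_col)
  qed
  have "(\<integral>\<^sup>+\<omega>. ennreal (exp (t * (\<Sum>j=0..<L. (norm (\<Sum>s\<in>S. u s * Z s j \<omega>))\<^sup>2))) \<partial>M)
    = (\<integral>\<^sup>+\<omega>. (\<Prod>j=0..<L. g j (restrict (\<lambda>i. ?Z i \<omega>) (S \<times> {j}))) \<partial>M)"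
    by (simp add: g sum_col sum_distrib_left exp_sum prod_ennreal)
  also have "\<dots> = (\<Prod>j=0..<L. \<integral>\<^sup>+\<omega>. g j (restrict (\<lambda>i. ?Z i \<omega>) (S \<times> {j})) \<partial>M)"
    by (rule indep_vars_nn_integral[OF _ ind]) auto
  also have "\<dots> = (\<Prod>j=0..<L. ennreal (?D powr (- (\<kappa> / 2))))"
    by (intro prod.cong refl col) simp
  also have "\<dots> = ennreal ((?D powr (- (\<kappa> / 2))) ^ L)" by (simp add: ennreal_power)
  also have "(?D powr (- (\<kappa> / 2))) ^ L = ?D powr (- (\<kappa> * L / 2))"
    using t by (simp add: powr_powr flip: powr_realpow)
  finally show ?thesis .
qed

lemma (in prob_space) quadratic_mgf_real_normal:
  assumes X: "distributed M lborel X std_normal_density"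
  shows "quadratic_mgf 1 (distr M borel X)"
proof (rule quadratic_mgfI)
  have [measurable]: "random_variable borel X"
    using distributed_measurable[OF X] by simp
  show "prob_space (distr M borel X)" by (rule prob_space_distr) simp
  fix a s :: real assume s: "2 * s < 1"
  have "(\<integral>\<^sup>+y. ennreal (exp (s * (norm (a + y))\<^sup>2)) \<partial>distr M borel X)
      = (\<integral>\<^sup>+\<omega>. ennreal (exp (s * (a + X \<omega>)\<^sup>2)) \<partial>M)"
    by (subst nn_integral_distr) auto
  also have "\<dots> = (\<integral>\<^sup>+x. ennreal (std_normal_density x) * ennreal (exp (s * (a + x)\<^sup>2)) \<partial>lborel)"
    by (rule distributed_nn_integral[OF X, symmetric]) simp
  finally show "(\<integral>\<^sup>+y. ennreal (exp (s * (norm (a + y))\<^sup>2)) \<partial>distr M borel X)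
      = ennreal ((1 - 2 * s) powr (- (1 / 2)) * exp (s * (norm a)\<^sup>2 / (1 - 2 * s)))"
    by (simp add: nn_integral_exp_square_std_normal[OF s])
qed

text \<open>The squared modulus separates into real and imaginary parts; the two independent real
  factors multiply, doubling the exponent.\<close>

lemma (in prob_space) quadratic_mgf_complex_normal:
  fixes Z :: "'a \<Rightarrow> complex"
  assumes Re: "distributed M lborel (\<lambda>\<omega>. Re (Z \<omega>)) std_normal_density"
    and Im: "distributed M lborel (\<lambda>\<omega>. Im (Z \<omega>)) std_normal_density"
    and indep: "indep_vars (\<lambda>_. borel) (\<lambda>b \<omega>. if b then Re (Z \<omega>) else Im (Z \<omega>)) UNIV"
  shows "quadratic_mgf 2 (distr M borel Z)"
proof (rule quadratic_mgfI)
  have [measurable]: "random_variable borel (\<lambda>\<omega>. Re (Z \<omega>))" "random_variable borel (\<lambda>\<omega>. Im (Z \<omega>))"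
    using distributed_measurable[OF Re] distributed_measurable[OF Im] by simp_all
  then have [measurable]: "random_variable borel Z"
    by (simp add: borel_measurable_complex_iff)
  show "prob_space (distr M borel Z)" by (rule prob_space_distr) simp
  fix a :: complex and s :: real assume s: "2 * s < 1"
  define g where "g b x = ennreal (exp (s * ((if b then Re a else Im a) + x)\<^sup>2))" for b x
  have 1: "(\<integral>\<^sup>+\<omega>. g b (if b then Re (Z \<omega>) else Im (Z \<omega>)) \<partial>M)
      = ennreal ((1 - 2 * s) powr (- (1/2)) * exp (s * (if b then Re a else Im a)\<^sup>2 / (1 - 2 * s)))" for b
    unfolding g_def
    using distributed_nn_integral[OF Re, of "\<lambda>x. ennreal (exp (s * (Re a + x)\<^sup>2))"]
      distributed_nn_integral[OF Im, of "\<lambda>x. ennreal (exp (s * (Im a + x)\<^sup>2))"]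
    by (cases b) (simp_all add: nn_integral_exp_square_std_normal[OF s])
  have ind: "indep_vars (\<lambda>_. borel) (\<lambda>b \<omega>. g b (if b then Re (Z \<omega>) else Im (Z \<omega>))) UNIV"
    by (rule indep_vars_compose2[OF indep]) (simp add: g_def)
  have "(\<integral>\<^sup>+y. ennreal (exp (s * (norm (a + y))\<^sup>2)) \<partial>distr M borel Z)
      = (\<integral>\<^sup>+\<omega>. (\<Prod>b\<in>UNIV. g b (if b then Re (Z \<omega>) else Im (Z \<omega>))) \<partial>M)"
    by (subst nn_integral_distr)
       (auto simp: g_def UNIV_bool cmod_power2 distrib_left exp_add mult.commute simp flip: ennreal_mult')
  also have "\<dots> = (\<Prod>b\<in>UNIV. \<integral>\<^sup>+\<omega>. g b (if b then Re (Z \<omega>) else Im (Z \<omega>)) \<partial>M)"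
    by (rule indep_vars_nn_integral[OF _ ind]) auto
  also have "\<dots> = ennreal ((1 - 2 * s) powr (- (1/2)) * exp (s * (Re a)\<^sup>2 / (1 - 2 * s)) *
      ((1 - 2 * s) powr (- (1/2)) * exp (s * (Im a)\<^sup>2 / (1 - 2 * s))))"
    unfolding 1 by (simp add: UNIV_bool mult.commute flip: ennreal_mult')
  also have "(1 - 2 * s) powr (- (1/2)) * exp (s * (Re a)\<^sup>2 / (1 - 2 * s)) *
      ((1 - 2 * s) powr (- (1/2)) * exp (s * (Im a)\<^sup>2 / (1 - 2 * s)))
    = (1 - 2 * s) powr (- (1/2) + - (1/2)) * exp (s * (Re a)\<^sup>2 / (1 - 2 * s) + s * (Im a)\<^sup>2 / (1 - 2 * s))"
    by (simp only: powr_add exp_add mult_ac)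
  also have "\<dots> = (1 - 2 * s) powr (- (2 / 2)) * exp (s * (norm a)\<^sup>2 / (1 - 2 * s))"
    by (simp add: cmod_power2 distrib_left add_divide_distrib)
  finally show "(\<integral>\<^sup>+y. ennreal (exp (s * (norm (a + y))\<^sup>2)) \<partial>distr M borel Z)
      = ennreal ((1 - 2 * s) powr (- (2 / 2)) * exp (s * (norm a)\<^sup>2 / (1 - 2 * s)))" .
qed

text \<open>For complex \<open>u\<close> the squared norm is the sum of two dependent quadratic
  forms in the same real Gaussians, coming from the real and imaginary parts of \<open>u\<close>.
  The bound is the value attained when all the energy of \<open>u\<close> lies in one real
  vector.\<close>

lemma (in prob_space) mgf_real_matrix:
  fixes \<Phi> :: "'a \<Rightarrow> nat \<Rightarrow> nat \<Rightarrow> real"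
  assumes fin: "finite S"
    and indep: "indep_vars (\<lambda>_. borel) (\<lambda>(s, j) \<omega>. \<Phi> \<omega> s j) (S \<times> {0..<L})"
    and dist: "\<forall>s\<in>S. \<forall>j<L. distributed M lborel (\<lambda>\<omega>. \<Phi> \<omega> s j) std_normal_density"
    and t: "2 * t * (vnorm S u)\<^sup>2 < 1"
  shows "(\<integral>\<^sup>+\<omega>. ennreal (exp (t * (vnorm {0..<L} (\<lambda>j. \<Sum>s\<in>S. u s * complex_of_real (\<Phi> \<omega> s j)))\<^sup>2)) \<partial>M)
    \<le> ennreal ((1 - 2 * t * (vnorm S u)\<^sup>2) powr (- (real L / 2)))"
proof -
  define v where "v = (vnorm S u)\<^sup>2"
  define a b where "a = (\<Sum>s\<in>S. (Re (u s))\<^sup>2)" and "b = (\<Sum>s\<in>S. (Im (u s))\<^sup>2)"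
  define Q where "Q r \<omega> = (\<Sum>j=0..<L. (\<Sum>s\<in>S. r s * \<Phi> \<omega> s j)\<^sup>2)" for r :: "nat \<Rightarrow> real" and \<omega>
  have ab: "0 \<le> a" "0 \<le> b" by (simp_all add: a_def b_def sum_nonneg)
  have v: "v = a + b" by (simp add: v_def a_def b_def vnorm_def sum_nonneg cmod_power2 sum.distrib)
  have rv [measurable]: "random_variable borel (\<lambda>\<omega>. \<Phi> \<omega> s j)" if "s \<in> S" "j \<in> {0..<L}" for s j
    using dist that distributed_measurable[of M lborel "\<lambda>\<omega>. \<Phi> \<omega> s j"] by auto
  have norm: "(vnorm {0..<L} (\<lambda>j. \<Sum>s\<in>S. u s * complex_of_real (\<Phi> \<omega> s j)))\<^sup>2
      = Q (\<lambda>s. Re (u s)) \<omega> + Q (\<lambda>s. Im (u s)) \<omega>" for \<omega>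
    by (simp add: vnorm_def sum_nonneg cmod_power2 Q_def sum.distrib)
  have meas [measurable]: "random_variable borel (Q r)" for r
    unfolding Q_def[abs_def] by measurable
  have Q: "(\<integral>\<^sup>+\<omega>. ennreal (exp (t * Q r \<omega>)) \<partial>M)
      = ennreal ((1 - 2 * t * (\<Sum>s\<in>S. (r s)\<^sup>2)) powr (- (real L / 2)))"
    if "2 * t * (\<Sum>s\<in>S. (r s)\<^sup>2) < 1" for t r
    using quadratic_mgf_columns[OF fin, of "\<lambda>s j \<omega>. \<Phi> \<omega> s j" L 1 t r] indep dist that
    by (simp add: Q_def quadratic_mgf_real_normal)
  show ?thesis
  proof (cases "v = 0")
    case True
    then have "\<forall>s\<in>S. u s = 0" using fin by (simp add: v_def vnorm_eq_0_iff)
    then show ?thesis using True by (simp add: v_def vnorm_def emeasure_space_1)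
  next
    case False
    then have vpos: "v > 0" using ab v by linarith
    let ?I = "ennreal ((1 - 2 * t * v) powr (- (real L / 2)))"
    \<comment> \<open>Rescaling by \<open>v / c\<close> gives both forms the same integral. If
      \<open>c = 0\<close>, the weight \<open>c / v\<close> is zero and both sides vanish.\<close>
    have part: "(\<integral>\<^sup>+\<omega>. ennreal (c / v) * ennreal (exp (t * (v / c * Q r \<omega>))) \<partial>M) = ennreal (c / v) * ?I"
      if c: "c = (\<Sum>s\<in>S. (r s)\<^sup>2)" for c r
    proof (cases "c = 0")
      case True
      then show ?thesis by simp
    next
      case False
      then have "2 * (t * (v / c)) * (\<Sum>s\<in>S. (r s)\<^sup>2) = 2 * t * v" by (simp flip: c)
      then have "(\<integral>\<^sup>+\<omega>. ennreal (exp (t * (v / c) * Q r \<omega>)) \<partial>M) = ?I"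
        using Q[of "t * (v / c)" r] t by (simp only: v_def)
      then show ?thesis by (subst nn_integral_cmult) (simp_all add: mult.assoc)
    qed
    have split: "Q r \<omega> = c / v * (v / c * Q r \<omega>)" if "c = (\<Sum>s\<in>S. (r s)\<^sup>2)" for c r \<omega>
    proof (cases "c = 0")
      case True
      then have "\<forall>s\<in>S. r s = 0" using fin that by (simp add: sum_nonneg_eq_0_iff)
      then show ?thesis by (simp add: Q_def)
    next
      case False
      then show ?thesis using vpos by simp
    qed
    \<comment> \<open>Convexity of \<open>exp\<close> with weights \<open>a / v\<close> and \<open>b / v\<close>: the real and imaginary parts are dependent.\<close>
    have "(\<integral>\<^sup>+\<omega>. ennreal (exp (t * (Q (\<lambda>s. Re (u s)) \<omega> + Q (\<lambda>s. Im (u s)) \<omega>))) \<partial>M)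
      \<le> (\<integral>\<^sup>+\<omega>. ennreal (a / v) * ennreal (exp (t * (v / a * Q (\<lambda>s. Re (u s)) \<omega>)))
            + ennreal (b / v) * ennreal (exp (t * (v / b * Q (\<lambda>s. Im (u s)) \<omega>))) \<partial>M)"
    proof (rule nn_integral_mono)
      fix \<omega>
      let ?A = "t * (v / a * Q (\<lambda>s. Re (u s)) \<omega>)" and ?B = "t * (v / b * Q (\<lambda>s. Im (u s)) \<omega>)"
      have "t * (Q (\<lambda>s. Re (u s)) \<omega> + Q (\<lambda>s. Im (u s)) \<omega>) = (a / v) * ?A + (b / v) * ?B"
        by (subst split[OF a_def], subst split[OF b_def]) (simp add: algebra_simps)
      moreover have "exp ((a / v) * ?A + (b / v) * ?B) \<le> (a / v) * exp ?A + (b / v) * exp ?B"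
      proof -
        have exp_convex: "exp (\<alpha> * x + \<beta> * y) \<le> \<alpha> * exp x + \<beta> * exp y"
          if "0 \<le> \<alpha>" "0 \<le> \<beta>" "\<alpha> + \<beta> = 1" for \<alpha> \<beta> x y :: real
          using convex_on_exp[of 1] that by (auto simp: convex_on_def)
        have "a / v + b / v = 1" using vpos v by (simp flip: add_divide_distrib)
        then show ?thesis
          using ab vpos by (intro exp_convex) auto
      qed
      ultimately show "ennreal (exp (t * (Q (\<lambda>s. Re (u s)) \<omega> + Q (\<lambda>s. Im (u s)) \<omega>)))
        \<le> ennreal (a / v) * ennreal (exp ?A) + ennreal (b / v) * ennreal (exp ?B)"
        using ab vpos by (simp add: ennreal_leI flip: ennreal_mult' ennreal_plus)
    qed
    also have "\<dots> = ennreal (a / v) * ?I + ennreal (b / v) * ?I"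
      by (subst nn_integral_add) (simp_all only: part[OF a_def] part[OF b_def], measurable)
    also have "\<dots> = (ennreal (a / v) + ennreal (b / v)) * ?I" by (simp add: distrib_right)
    also have "ennreal (a / v) + ennreal (b / v) = 1"
      using ab vpos by (simp add: v flip: ennreal_plus add_divide_distrib)
    finally show ?thesis by (simp add: norm v_def)
  qed
qed

text \<open>Grouping the real family in pairs gives independent complex entries; grouping it in
  singletons gives independent parts of one entry. Complex coefficients are already covered by
  \<open>quadratic_mgf\<close>, so equality holds here.\<close>

lemma (in prob_space) mgf_complex_matrix:
  fixes \<Phi> :: "'a \<Rightarrow> nat \<Rightarrow> nat \<Rightarrow> complex"
  assumes fin: "finite S"
    and indep: "indep_vars (\<lambda>_. borel)
         (\<lambda>(s, j, b) \<omega>. if b then Re (\<Phi> \<omega> s j) else Im (\<Phi> \<omega> s j)) (S \<times> {0..<L} \<times> UNIV)"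
    and dist: "\<forall>s\<in>S. \<forall>j<L. distributed M lborel (\<lambda>\<omega>. Re (\<Phi> \<omega> s j)) std_normal_density
                   \<and> distributed M lborel (\<lambda>\<omega>. Im (\<Phi> \<omega> s j)) std_normal_density"
    and t: "2 * t * (vnorm S u)\<^sup>2 < 1"
  shows "(\<integral>\<^sup>+\<omega>. ennreal (exp (t * (vnorm {0..<L} (\<lambda>j. \<Sum>s\<in>S. u s * \<Phi> \<omega> s j))\<^sup>2)) \<partial>M)
    = ennreal ((1 - 2 * t * (vnorm S u)\<^sup>2) powr (- (real (2 * L) / 2)))"
proof -
  let ?X = "\<lambda>(s, j, b) \<omega>. if b then Re (\<Phi> \<omega> s j) else Im (\<Phi> \<omega> s j)"
  let ?K = "\<lambda>(s, j). {(s, j, True), (s, j, False)}"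
  have "indep_vars (\<lambda>i. PiM (?K i) (\<lambda>_. borel)) (\<lambda>i \<omega>. restrict (\<lambda>k. ?X k \<omega>) (?K i)) (S \<times> {0..<L})"
    by (rule indep_vars_restrict[OF indep]) (auto simp: disjoint_family_on_def)
  then have "indep_vars (\<lambda>_. borel) (\<lambda>i \<omega>. (\<lambda>(s, j) x. Complex (x (s, j, True)) (x (s, j, False))) i
      (restrict (\<lambda>k. ?X k \<omega>) (?K i))) (S \<times> {0..<L})"
    by (rule indep_vars_compose2) (auto simp: borel_measurable_complex_iff intro!: measurable_component_singleton)
  then have ind: "indep_vars (\<lambda>_. borel) (\<lambda>(s, j) \<omega>. \<Phi> \<omega> s j) (S \<times> {0..<L})"
    by (rule indep_vars_cong[THEN iffD1, rotated -1]) auto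
  have mgf: "quadratic_mgf 2 (distr M borel (\<lambda>\<omega>. \<Phi> \<omega> s j))" if "s \<in> S" "j < L" for s j
  proof (rule quadratic_mgf_complex_normal)
    have "indep_vars (\<lambda>b. PiM {(s, j, b)} (\<lambda>_. borel)) (\<lambda>b \<omega>. restrict (\<lambda>k. ?X k \<omega>) {(s, j, b)}) UNIV"
      by (rule indep_vars_restrict[OF indep]) (use that in \<open>auto simp: disjoint_family_on_def\<close>)
    then have "indep_vars (\<lambda>_. borel) (\<lambda>b \<omega>. (\<lambda>x. x (s, j, b)) (restrict (\<lambda>k. ?X k \<omega>) {(s, j, b)})) UNIV"
      by (rule indep_vars_compose2) (auto intro!: measurable_component_singleton)
    then show "indep_vars (\<lambda>_. borel) (\<lambda>b \<omega>. if b then Re (\<Phi> \<omega> s j) else Im (\<Phi> \<omega> s j)) UNIV" by simp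
  qed (use dist that in auto)
  from quadratic_mgf_columns[OF fin, of "\<lambda>s j \<omega>. \<Phi> \<omega> s j" L 2 t u] ind mgf t
  show ?thesis by (simp add: vnorm_def sum_nonneg)
qed

section \<open>Probability of success\<close>

text \<open>The scale \<open>\<tau>\<close> makes the squared thresholds equal x K v^2 at the two
  balanced values of x. The exponent bound 2 \<epsilon>^2 times K / 2 then gives \<epsilon>^2
  K.\<close>

lemma (in prob_space) norm_tails:
  fixes F :: "'a \<Rightarrow> real"
  assumes [measurable]: "random_variable borel F" and F: "\<And>\<omega>. 0 \<le> F \<omega>" and v: "v > 0" and K: "K > 0"
    and mgf: "\<And>t. 2 * t * v\<^sup>2 < 1 \<Longrightarrow>
      (\<integral>\<^sup>+\<omega>. ennreal (exp (t * (F \<omega>)\<^sup>2)) \<partial>M) \<le> ennreal ((1 - 2 * t * v\<^sup>2) powr (- (K / 2)))"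
    and eps: "0 < \<epsilon>" "\<epsilon> < 1"
  defines "\<tau> \<equiv> sqrt (artanh \<epsilon> / \<epsilon> * K)"
  shows "prob {\<omega> \<in> space M. (1 + \<epsilon>) * \<tau> * v < F \<omega>} \<le> exp (- (\<epsilon>\<^sup>2 * K))" (is "prob ?U \<le> _")
    and "prob {\<omega> \<in> space M. F \<omega> \<le> (1 - \<epsilon>) * \<tau> * v} \<le> exp (- (\<epsilon>\<^sup>2 * K))" (is "prob ?D \<le> _")
proof -
  note * = balanced_exponents[OF eps]
  define \<gamma> where "\<gamma> = artanh \<epsilon> / \<epsilon>"
  have \<gamma>: "\<gamma> > 0" using *(1) by (simp add: \<gamma>_def)
  have \<tau>: "0 \<le> \<tau>" "\<tau>\<^sup>2 = \<gamma> * K" using \<gamma> K by (auto simp: \<tau>_def \<gamma>_def[symmetric])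
  have sq: "(c * \<tau> * v)\<^sup>2 = c\<^sup>2 * \<gamma> * K * v\<^sup>2" for c
    using \<tau>(2) by (simp add: power_mult_distrib mult_ac)
  have weaken: "exp (- (K / 2 * (x - 1 - ln x))) \<le> exp (- (\<epsilon>\<^sup>2 * K))" if "2 * \<epsilon>\<^sup>2 \<le> x - 1 - ln x" for x
    using mult_left_mono[OF that, of "K / 2"] K by (simp add: mult_ac)
  have "prob ?U \<le> exp (- (K / 2 * ((1 + \<epsilon>)\<^sup>2 * \<gamma> - 1 - ln ((1 + \<epsilon>)\<^sup>2 * \<gamma>))))"
  proof (rule chi_square_Chernoff[OF _ _ _ mgf])
    fix \<omega> assume "(1 + \<epsilon>) * \<tau> * v < F \<omega>"
    then have "((1 + \<epsilon>) * \<tau> * v)\<^sup>2 \<le> (F \<omega>)\<^sup>2"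
      using eps \<tau> v by (intro power_mono) auto
    then show "0 \<le> ((1 + \<epsilon>)\<^sup>2 * \<gamma> - 1) * ((F \<omega>)\<^sup>2 - (1 + \<epsilon>)\<^sup>2 * \<gamma> * K * v\<^sup>2)"
      using *(2) by (intro mult_nonneg_nonneg) (auto simp: sq \<gamma>_def)
  qed (use v eps \<gamma> in auto)
  also have "\<dots> \<le> exp (- (\<epsilon>\<^sup>2 * K))" by (rule weaken) (use *(4) in \<open>simp add: \<gamma>_def\<close>)
  finally show "prob ?U \<le> exp (- (\<epsilon>\<^sup>2 * K))" .
  have "prob ?D \<le> exp (- (K / 2 * ((1 - \<epsilon>)\<^sup>2 * \<gamma> - 1 - ln ((1 - \<epsilon>)\<^sup>2 * \<gamma>))))"
  proof (rule chi_square_Chernoff[OF _ _ _ mgf])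
    fix \<omega> assume "F \<omega> \<le> (1 - \<epsilon>) * \<tau> * v"
    then have "(F \<omega>)\<^sup>2 \<le> ((1 - \<epsilon>) * \<tau> * v)\<^sup>2" using F by (intro power_mono) auto
    then show "0 \<le> ((1 - \<epsilon>)\<^sup>2 * \<gamma> - 1) * ((F \<omega>)\<^sup>2 - (1 - \<epsilon>)\<^sup>2 * \<gamma> * K * v\<^sup>2)"
      using *(3) by (intro mult_nonpos_nonpos) (auto simp: sq \<gamma>_def)
  qed (use v eps \<gamma> in auto)
  also have "\<dots> \<le> exp (- (\<epsilon>\<^sup>2 * K))" by (rule weaken) (use *(5) in \<open>simp add: \<gamma>_def\<close>)
  finally show "prob ?D \<le> exp (- (\<epsilon>\<^sup>2 * K))" .
qed

text \<open>The real and complex cases differ only in the value of \<open>K\<close> in the moment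
  bound. The selected set is random, but the union bound runs over all proper subsets
  \<open>J\<close>, for each of which the vectors \<open>w J m\<close> are deterministic.\<close>

lemma (in prob_space) somp_success_probability:
  fixes \<phi> :: "'a \<Rightarrow> nat \<Rightarrow> nat \<Rightarrow> complex" and \<sigma> :: "nat \<Rightarrow> real" and K :: nat
  assumes unit_cols: "\<forall>l<N. (\<Sum>r<n. (cmod (A r l))^2) = 1"
    and S: "S \<subseteq> {0..<N}"
    and delta: "delta A n S < 1"
    and eps: "0 < \<epsilon>" "\<epsilon> < 1"
    and cond: "((mu2 A n N S)^2 + (1 + \<epsilon>) / (1 - \<epsilon>) * mu2 A n N S) / (1 - delta A n S) \<le> 1"
    and sigma: "\<forall>s\<in>S. \<sigma> s > 0"
    and K: "K > 0"
    and rv: "\<And>s j. s \<in> S \<Longrightarrow> j < L \<Longrightarrow> random_variable borel (\<lambda>\<omega>. \<phi> \<omega> s j)"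
    and mgf: "\<And>u t. 2 * t * (vnorm S u)\<^sup>2 < 1 \<Longrightarrow>
      (\<integral>\<^sup>+\<omega>. ennreal (exp (t * (vnorm {0..<L} (\<lambda>j. \<Sum>s\<in>S. u s * \<phi> \<omega> s j))\<^sup>2)) \<partial>M)
        \<le> ennreal ((1 - 2 * t * (vnorm S u)\<^sup>2) powr (- (real K / 2)))"
  shows "\<exists>E \<in> events.
      E \<subseteq> {\<omega> \<in> space M. somp_selects A n N L
             (matmul A N (\<lambda>l j. if l \<in> S \<and> j < L then complex_of_real (\<sigma> l) * \<phi> \<omega> l j else 0)) S} \<and>
      prob E \<ge> 1 - real N * 2 ^ card S * exp (- (\<epsilon>^2 * (A_const K)^2))"
proof -
  have fin: "finite S" using S finite_subset by blast
  interpret stable_support A n S using fin delta by unfold_locales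
  define w where "w J l s = res_gram A n J l s * complex_of_real (\<sigma> s)" for J l s
  define F where "F u \<omega> = vnorm {0..<L} (\<lambda>j. \<Sum>s\<in>S. u s * \<phi> \<omega> s j)" for u \<omega>
  define \<tau> where "\<tau> = sqrt (artanh \<epsilon> / \<epsilon> * K)"
  define p where "p = exp (- (\<epsilon>\<^sup>2 * K))"
  note rv [measurable]
  have meas_F [measurable]: "random_variable borel (F u)" for u
    unfolding F_def[abs_def] vnorm_def by measurable
  have tails: "prob {\<omega> \<in> space M. (1 + \<epsilon>) * \<tau> * vnorm S u < F u \<omega>} \<le> p"
    "prob {\<omega> \<in> space M. F u \<omega> \<le> (1 - \<epsilon>) * \<tau> * vnorm S u} \<le> p" if "0 < vnorm S u" for u
  proof -
    have "(\<integral>\<^sup>+\<omega>. ennreal (exp (t * (F u \<omega>)\<^sup>2)) \<partial>M)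
        \<le> ennreal ((1 - 2 * t * (vnorm S u)\<^sup>2) powr (- (real K / 2)))"
      if "2 * t * (vnorm S u)\<^sup>2 < 1" for t
      using mgf[OF that] by (simp add: F_def)
    note norm_tails[OF meas_F _ that _ this eps]
    then show "prob {\<omega> \<in> space M. (1 + \<epsilon>) * \<tau> * vnorm S u < F u \<omega>} \<le> p"
      "prob {\<omega> \<in> space M. F u \<omega> \<le> (1 - \<epsilon>) * \<tau> * vnorm S u} \<le> p"
      using K unfolding p_def \<tau>_def by (simp_all add: F_def)
  qed
  \<comment> \<open>A zero vector makes \<open>F\<close> vanish, so the strict event is empty and no
    division by its norm arises.\<close>
  have upper: "prob {\<omega> \<in> space M. (1 + \<epsilon>) * \<tau> * vnorm S u < F u \<omega>} \<le> p" for u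
  proof (cases "vnorm S u = 0")
    case True
    then have "F u \<omega> = 0" for \<omega> using fin by (simp add: F_def vnorm_eq_0_iff)
    with True show ?thesis by (simp add: p_def)
  next
    case False
    then show ?thesis using vnorm_nonneg[of S u] by (intro tails) linarith
  qed
  define good where "good J l \<longleftrightarrow> l \<in> S \<and> 0 < vnorm S (w J l) \<and>
      (\<forall>m<N. m \<notin> S \<longrightarrow> (1 + \<epsilon>) * vnorm S (w J m) \<le> (1 - \<epsilon>) * vnorm S (w J l))" for J l
  have "\<exists>l. good J l" if "J \<subset> S" for J
    using residual_correlation_gap[OF unit_cols S delta eps cond sigma that]
    unfolding good_def w_def by blast
  \<comment> \<open>The comparison index is fixed for each \<open>J\<close> independently of the
    outcome, so a single lower-tail event per \<open>J\<close> suffices.\<close>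
  then obtain best where "\<And>J. J \<subset> S \<Longrightarrow> good J (best J)" by metis
  then have best: "best J \<in> S" "0 < vnorm S (w J (best J))"
    "m < N \<Longrightarrow> m \<notin> S \<Longrightarrow> (1 + \<epsilon>) * vnorm S (w J m) \<le> (1 - \<epsilon>) * vnorm S (w J (best J))"
    if "J \<subset> S" for J m
    using that by (simp_all add: good_def)
  define U where "U J m = {\<omega> \<in> space M. (1 + \<epsilon>) * \<tau> * vnorm S (w J m) < F (w J m) \<omega>}" for J m
  define D where "D J = {\<omega> \<in> space M. F (w J (best J)) \<omega> \<le> (1 - \<epsilon>) * \<tau> * vnorm S (w J (best J))}" for J
  define B where "B J = D J \<union> (\<Union>m\<in>{0..<N} - S. U J m)" for J
  define E where "E = space M - (\<Union>J\<in>Pow S - {S}. B J)"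
  have [measurable]: "U J m \<in> events" "D J \<in> events" for J m
    unfolding U_def D_def by measurable
  have [measurable]: "B J \<in> events" for J unfolding B_def by measurable
  have E: "E \<in> events" using fin unfolding E_def by (intro sets.Diff sets.finite_UN) auto
  have \<tau>0: "0 \<le> \<tau>" unfolding \<tau>_def using balanced_exponents(1)[OF eps]
    by (intro real_sqrt_ge_zero mult_nonneg_nonneg) auto
  have "somp_selects A n N L
      (matmul A N (\<lambda>l j. if l \<in> S \<and> j < L then complex_of_real (\<sigma> l) * \<phi> \<omega> l j else 0)) S"
    (is "somp_selects A n N L ?Y S") if \<omega>: "\<omega> \<in> E" for \<omega>
  proof (rule somp_selectsI[OF fin S])
    fix J assume J: "J \<subset> S"
    have corr: "corr A n L (resid A n L J ?Y) m = F (w J m) \<omega>" for m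
    proof -
      have "corr A n L (resid A n L J ?Y) m = vnorm {0..<L} (\<lambda>j. \<Sum>s\<in>S. res_gram A n J m s *
          (if s \<in> S \<and> j < L then complex_of_real (\<sigma> s) * \<phi> \<omega> s j else 0))"
        using J by (intro corr_resid cnj_cols_matmul S) auto
      also have "\<dots> = F (w J m) \<omega>"
        unfolding F_def w_def by (intro vnorm_cong sum.cong) (auto simp: mult.assoc)
      finally show ?thesis .
    qed
    have \<omega>B: "\<omega> \<in> space M" "\<omega> \<notin> B J" using \<omega> J by (auto simp: E_def)
    then have low: "(1 - \<epsilon>) * \<tau> * vnorm S (w J (best J)) < F (w J (best J)) \<omega>"
      by (auto simp: B_def D_def)
    have "F (w J m) \<omega> < F (w J (best J)) \<omega>" if m: "m < N" "m \<notin> S - J" for m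
    proof (cases "m \<in> J")
      case True
      then have "F (w J m) \<omega> = 0"
        using J by (simp add: F_def w_def res_gram_left_zero vnorm_def)
      also have "0 \<le> (1 - \<epsilon>) * \<tau> * vnorm S (w J (best J))" using eps \<tau>0 by simp
      finally show ?thesis using low by linarith
    next
      case False
      with m have mS: "m \<notin> S" by auto
      have "F (w J m) \<omega> \<le> (1 + \<epsilon>) * \<tau> * vnorm S (w J m)"
        using \<omega>B m mS by (fastforce simp: B_def U_def not_less)
      also have "\<dots> = \<tau> * ((1 + \<epsilon>) * vnorm S (w J m))" by simp
      also have "\<dots> \<le> \<tau> * ((1 - \<epsilon>) * vnorm S (w J (best J)))"
        by (intro mult_left_mono best J m mS \<tau>0)
      finally show ?thesis using low by (simp add: mult_ac)
    qed
    then show "\<exists>l\<in>S. \<forall>m<N. m \<notin> S - J \<longrightarrow>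
        corr A n L (resid A n L J ?Y) m < corr A n L (resid A n L J ?Y) l"
      using best(1)[OF J] by (auto simp: corr)
  qed
  then have sub: "E \<subseteq> {\<omega> \<in> space M. somp_selects A n N L
      (matmul A N (\<lambda>l j. if l \<in> S \<and> j < L then complex_of_real (\<sigma> l) * \<phi> \<omega> l j else 0)) S}"
    by (auto simp: E_def)
  have cardS: "card S \<le> N" using card_mono[OF _ S] by simp
  have PB: "prob (B J) \<le> real (N - card S + 1) * p" if J: "J \<in> Pow S - {S}" for J
  proof -
    have "prob (B J) \<le> prob (D J) + prob (\<Union>m\<in>{0..<N} - S. U J m)"
      unfolding B_def by (intro measure_Un_le) auto
    also have "prob (\<Union>m\<in>{0..<N} - S. U J m) \<le> (\<Sum>m\<in>{0..<N} - S. prob (U J m))"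
      by (intro measure_UNION_le) auto
    also have "\<dots> \<le> (\<Sum>m\<in>{0..<N} - S. p)"
      unfolding U_def by (intro sum_mono upper)
    also have "\<dots> = real (N - card S) * p"
      using S fin by (simp add: card_Diff_subset)
    also have "prob (D J) \<le> p" unfolding D_def using J by (intro tails best) auto
    finally show ?thesis by (simp add: algebra_simps)
  qed
  have "prob (\<Union>J\<in>Pow S - {S}. B J) \<le> (\<Sum>J\<in>Pow S - {S}. prob (B J))"
    using fin by (intro measure_UNION_le) auto
  also have "\<dots> \<le> (\<Sum>J\<in>Pow S - {S}. real (N - card S + 1) * p)"
    by (intro sum_mono PB)
  also have "\<dots> = real (card (Pow S - {S})) * (real (N - card S + 1) * p)" by simp
  also have "card (Pow S - {S}) = 2 ^ card S - 1"
    using fin by (simp add: card_Pow card_Diff_subset)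
  also have "real (2 ^ card S - 1) * (real (N - card S + 1) * p) = real ((2 ^ card S - 1) * (N - card S + 1)) * p"
    by (simp only: of_nat_mult mult.assoc)
  also have "\<dots> \<le> real (N * 2 ^ card S) * p"
  proof (intro mult_right_mono of_nat_mono)
    \<comment> \<open>There are 2^k - 1 proper subsets with at most N - k + 1 events each. For k >=
      1 the second factor is at most N; for k = 0 the first factor is zero.\<close>
    show "(2 ^ card S - 1) * (N - card S + 1) \<le> N * 2 ^ card S"
    proof (cases "card S = 0")
      case False
      then have "N - card S + 1 \<le> N" using cardS by linarith
      then have "(2 ^ card S - 1) * (N - card S + 1) \<le> 2 ^ card S * N" by (intro mult_le_mono) auto
      then show ?thesis by (simp add: mult.commute)
    qed simp
  qed (simp add: p_def)
  also have "\<dots> \<le> real (N * 2 ^ card S) * exp (- (\<epsilon>\<^sup>2 * (A_const K)\<^sup>2))"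
    unfolding p_def using A_const_square_le[OF K] by (intro mult_left_mono) (auto intro!: mult_left_mono)
  finally have "1 - real N * 2 ^ card S * exp (- (\<epsilon>\<^sup>2 * (A_const K)\<^sup>2)) \<le> 1 - prob (\<Union>J\<in>Pow S - {S}. B J)"
    by simp
  also have "\<dots> = prob E"
    unfolding E_def using fin by (intro prob_compl[symmetric] sets.finite_UN) auto
  finally show ?thesis using E sub by blast
qed

theorem theorem9:
  fixes A :: "nat \<Rightarrow> nat \<Rightarrow> complex" and n N L :: nat and S :: "nat set"
    and \<epsilon> :: real and \<sigma> :: "nat \<Rightarrow> real"
  assumes L: "L \<ge> 1"
    and unit_cols: "\<forall>l<N. (\<Sum>r<n. (cmod (A r l))^2) = 1"
    and S: "S \<subseteq> {0..<N}"
    and delta: "delta A n S < 1" and mu: "mu2 A n N S < 1"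
    and eps: "0 < \<epsilon>" "\<epsilon> < 1"
    and cond: "((mu2 A n N S)^2 + (1 + \<epsilon>) / (1 - \<epsilon>) * mu2 A n N S) / (1 - delta A n S) \<le> 1"
    and sigma: "\<forall>s\<in>S. \<sigma> s > 0"
  shows
   "(\<forall>(M :: 'a measure) (\<Phi> :: 'a \<Rightarrow> nat \<Rightarrow> nat \<Rightarrow> real).
       prob_space M \<longrightarrow>
       prob_space.indep_vars M (\<lambda>_. borel) (\<lambda>(s, j) \<omega>. \<Phi> \<omega> s j) (S \<times> {0..<L}) \<longrightarrow>
       (\<forall>s\<in>S. \<forall>j<L. distributed M lborel (\<lambda>\<omega>. \<Phi> \<omega> s j) std_normal_density) \<longrightarrow>
       (\<exists>E \<in> sets M.
          E \<subseteq> {\<omega> \<in> space M. somp_selects A n N L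
                 (matmul A N (\<lambda>l j. if l \<in> S \<and> j < L then complex_of_real (\<sigma> l * \<Phi> \<omega> l j) else 0))
                 S} \<and>
          measure M E \<ge> 1 - real N * 2 ^ card S * exp (- (\<epsilon>^2 * (A_const L)^2))))
  \<and>
   (\<forall>(M :: 'a measure) (\<Phi> :: 'a \<Rightarrow> nat \<Rightarrow> nat \<Rightarrow> complex).
       prob_space M \<longrightarrow>
       prob_space.indep_vars M (\<lambda>_. borel)
         (\<lambda>(s, j, b) \<omega>. if b then Re (\<Phi> \<omega> s j) else Im (\<Phi> \<omega> s j)) (S \<times> {0..<L} \<times> UNIV) \<longrightarrow>
       (\<forall>s\<in>S. \<forall>j<L. distributed M lborel (\<lambda>\<omega>. Re (\<Phi> \<omega> s j)) std_normal_density
                   \<and> distributed M lborel (\<lambda>\<omega>. Im (\<Phi> \<omega> s j)) std_normal_density) \<longrightarrow>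
       (\<exists>E \<in> sets M.
          E \<subseteq> {\<omega> \<in> space M. somp_selects A n N L
                 (matmul A N (\<lambda>l j. if l \<in> S \<and> j < L then complex_of_real (\<sigma> l) * \<Phi> \<omega> l j else 0))
                 S} \<and>
          measure M E \<ge> 1 - real N * 2 ^ card S * exp (- (\<epsilon>^2 * (A_const (2 * L))^2))))"
proof (intro conjI allI impI)
  fix M :: "'a measure" and \<Phi> :: "'a \<Rightarrow> nat \<Rightarrow> nat \<Rightarrow> real"
  assume M: "prob_space M"
    and indep: "prob_space.indep_vars M (\<lambda>_. borel) (\<lambda>(s, j) \<omega>. \<Phi> \<omega> s j) (S \<times> {0..<L})"
    and dist: "\<forall>s\<in>S. \<forall>j<L. distributed M lborel (\<lambda>\<omega>. \<Phi> \<omega> s j) std_normal_density"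
  interpret prob_space M by fact
  have fin: "finite S" using S finite_subset by blast
  have rv: "random_variable borel (\<lambda>\<omega>. complex_of_real (\<Phi> \<omega> s j))" if "s \<in> S" "j < L" for s j
  proof -
    have "random_variable borel (\<lambda>\<omega>. \<Phi> \<omega> s j)"
      using dist that distributed_measurable[of M lborel "\<lambda>\<omega>. \<Phi> \<omega> s j"] by auto
    then show ?thesis by measurable
  qed
  show "\<exists>E \<in> sets M.
      E \<subseteq> {\<omega> \<in> space M. somp_selects A n N L
             (matmul A N (\<lambda>l j. if l \<in> S \<and> j < L then complex_of_real (\<sigma> l * \<Phi> \<omega> l j) else 0)) S} \<and>
      measure M E \<ge> 1 - real N * 2 ^ card S * exp (- (\<epsilon>^2 * (A_const L)^2))"
    unfolding of_real_mult using L
    by (intro somp_success_probability[OF unit_cols S delta eps cond sigma _ rv]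
        mgf_real_matrix[OF fin indep dist]) auto
next
  fix M :: "'a measure" and \<Phi> :: "'a \<Rightarrow> nat \<Rightarrow> nat \<Rightarrow> complex"
  assume M: "prob_space M"
    and indep: "prob_space.indep_vars M (\<lambda>_. borel)
         (\<lambda>(s, j, b) \<omega>. if b then Re (\<Phi> \<omega> s j) else Im (\<Phi> \<omega> s j)) (S \<times> {0..<L} \<times> UNIV)"
    and dist: "\<forall>s\<in>S. \<forall>j<L. distributed M lborel (\<lambda>\<omega>. Re (\<Phi> \<omega> s j)) std_normal_density
                   \<and> distributed M lborel (\<lambda>\<omega>. Im (\<Phi> \<omega> s j)) std_normal_density"
  interpret prob_space M by fact
  have fin: "finite S" using S finite_subset by blast
  have rv: "random_variable borel (\<lambda>\<omega>. \<Phi> \<omega> s j)" if "s \<in> S" "j < L" for s j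
    unfolding borel_measurable_complex_iff
    using dist that distributed_measurable[of M lborel "\<lambda>\<omega>. Re (\<Phi> \<omega> s j)"]
      distributed_measurable[of M lborel "\<lambda>\<omega>. Im (\<Phi> \<omega> s j)"] by auto
  show "\<exists>E \<in> sets M.
      E \<subseteq> {\<omega> \<in> space M. somp_selects A n N L
             (matmul A N (\<lambda>l j. if l \<in> S \<and> j < L then complex_of_real (\<sigma> l) * \<Phi> \<omega> l j else 0)) S} \<and>
      measure M E \<ge> 1 - real N * 2 ^ card S * exp (- (\<epsilon>^2 * (A_const (2 * L))^2))"
    using L
    by (intro somp_success_probability[OF unit_cols S delta eps cond sigma _ rv]
        eq_refl mgf_complex_matrix[OF fin indep dist]) auto
qed

end
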